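(* Let $k\subseteq\mathbb C$ be a field which does not contain $\sqrt5$. Let $m,n\in k$ be such that $-(m^2-5n^2-5)$ is the norm of some nonzero element $\eta\in k(\sqrt5)$ for the extension $k(\sqrt5)/k$. Let $\mu=m+n\sqrt5$ and let $C/k$ be the curve with Weierstrass model $$y^2=\mathrm{Tr}\!\left(\mu^2\eta^3\Bigl(\frac{1-x\sqrt5}{1+x\sqrt5}\Bigr)^3-2N(\mu)\mu\eta^2\Bigl(\frac{1-x\sqrt5}{1+x\sqrt5}\Bigr)^2-5N(\mu)(N(\mu)-5)\right)(1-5x^2)^3,$$ where $N$ and $\mathrm{Tr}$ denote the norm and trace from $k(\sqrt5)$ to $k$ respectively. When $C$ is a genus $2$ curve, the Igusa--Clebsch invariants $(I_2:I_4:I_6:I_{10})$ of $C$ are, writing $\nu=m^2-5n^2$, $$\bigl(20(2\nu-3) : 25(\nu-9)^2 : 5(75\nu^3+72m\nu^2-1165\nu^2-360m\nu+5985\nu-6399) : 8(m\nu^2+5\nu^2-5m\nu-45\nu+108)^2\bigr),$$ i.e. $C$ corresponds to the point $(m,n)$ in the $\mathbb P^2_{m,n}$ birational model of the Hilbert modular surface $Y_-(5)$.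
   Context: The trace is extended to rational functions in $x$, i.e. it is the trace from $k(\sqrt5)(x)$ to $k(x)$ (sum of an element and its conjugate under $\sqrt5\mapsto-\sqrt5$ with $x$ fixed). The factor $(1-5x^2)^3$ clears denominators, so the right-hand side is a polynomial in $k[x]$ of degree at most $6$, viewed as a sextic. Igusa--Clebsch invariants: for a genus $2$ curve $y^2=f(x)$, $f$ a sextic with leading coefficient $a$ and roots $x_1,\dots,x_6$ (with $(ij)=x_i-x_j$), $I_2=a^2\sum(12)^2(34)^2(56)^2$ (15 terms), $I_4=a^4\sum(12)^2(23)^2(31)^2(45)^2(56)^2(64)^2$ (10 terms), $I_6=a^6\sum(12)^2(23)^2(31)^2(45)^2(56)^2(64)^2(14)^2(25)^2(36)^2$ (60 terms), $I_{10}=a^{10}\prod_{i<j}(ij)^2=\mathrm{disc}(f)$ (these are polynomials in the coefficients of the binary sextic, so also make sense when the $x^6$-coefficient vanishes). They are considered as a point of weighted projective space $\mathbb P^3_{1,2,3,5}(\mathbb C)$, i.e. up to $(I_2,I_4,I_6,I_{10})\sim(\lambda I_2,\lambda^2I_4,\lambda^3I_6,\lambda^5I_{10})$, $\lambda\in\mathbb C^\times$. $Y_-(5)$ is the Hilbert modular surface parametrizing principally polarized abelian surfaces with real multiplication by $\mathbb Z[\frac{1+\sqrt5}2]$; the meaning of "corresponds to the point $(m,n)$" is exactly that the Igusa--Clebsch invariants are as displayed. *)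

theory Defs
  imports
    Complex_Main
    "HOL-Computational_Algebra.Polynomial_Factorial"
    "HOL-Computational_Algebra.Fundamental_Theorem_Algebra"
    "HOL-Computational_Algebra.Squarefree"
    "HOL-Combinatorics.Permutations"
begin

section \<open>The extension \<open>k(\<surd>5)/k\<close>\<close>

abbreviation sqrt5 :: complex where
  "sqrt5 \<equiv> complex_of_real (sqrt 5)"

definition is_subfield :: "complex set \<Rightarrow> bool" where
  "is_subfield k \<longleftrightarrow> 0 \<in> k \<and> 1 \<in> k \<and>
     (\<forall>x\<in>k. \<forall>y\<in>k. x + y \<in> k \<and> x * y \<in> k) \<and> (\<forall>x\<in>k. - x \<in> k \<and> inverse x \<in> k)"

definition adjoin_sqrt5 :: "complex set \<Rightarrow> complex set" where
  "adjoin_sqrt5 k = {a + b * sqrt5 | a b. a \<in> k \<and> b \<in> k}"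

definition conj5 :: "complex set \<Rightarrow> complex \<Rightarrow> complex" where
  "conj5 k z = (THE w. \<exists>a\<in>k. \<exists>b\<in>k. z = a + b * sqrt5 \<and> w = a - b * sqrt5)"

definition norm5 :: "complex set \<Rightarrow> complex \<Rightarrow> complex" where
  "norm5 k z = z * conj5 k z"

text \<open>
  \<open>k(\<surd>5)(x)\<close> is viewed inside the field \<open>complex poly fract\<close> of complex rational functions, as the
  quotients of polynomials with coefficients in \<open>k(\<surd>5)\<close>; the conjugation of \<open>k(\<surd>5)/k\<close> is extended
  to it by acting on coefficients (see \<open>rat_conj5_Fract\<close> for well-definedness).
\<close>

definition polys_over :: "complex set \<Rightarrow> complex poly set" where
  "polys_over K = {p. \<forall>i. coeff p i \<in> K}"

definition rat_conj5 :: "complex set \<Rightarrow> complex poly fract \<Rightarrow> complex poly fract" where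
  "rat_conj5 k r = (THE s. \<exists>p q. p \<in> polys_over (adjoin_sqrt5 k) \<and> q \<in> polys_over (adjoin_sqrt5 k) \<and>
     q \<noteq> 0 \<and> r = Fract p q \<and> s = Fract (map_poly (conj5 k) p) (map_poly (conj5 k) q))"

definition rat_trace5 :: "complex set \<Rightarrow> complex poly fract \<Rightarrow> complex poly fract" where
  "rat_trace5 k r = r + rat_conj5 k r"

lemma is_subfieldD:
  assumes "is_subfield k"
  shows "0 \<in> k" "1 \<in> k" "x \<in> k \<Longrightarrow> y \<in> k \<Longrightarrow> x + y \<in> k" "x \<in> k \<Longrightarrow> y \<in> k \<Longrightarrow> x * y \<in> k"
    "x \<in> k \<Longrightarrow> - x \<in> k" "x \<in> k \<Longrightarrow> inverse x \<in> k"
    "x \<in> k \<Longrightarrow> y \<in> k \<Longrightarrow> x - y \<in> k" "x \<in> k \<Longrightarrow> y \<in> k \<Longrightarrow> x / y \<in> k"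
proof -
  show "0 \<in> k" "1 \<in> k" "x \<in> k \<Longrightarrow> y \<in> k \<Longrightarrow> x + y \<in> k" "x \<in> k \<Longrightarrow> y \<in> k \<Longrightarrow> x * y \<in> k"
    "x \<in> k \<Longrightarrow> - x \<in> k" "x \<in> k \<Longrightarrow> inverse x \<in> k"
    using assms by (auto simp: is_subfield_def)
  show "x - y \<in> k" if "x \<in> k" "y \<in> k"
    using assms that by (simp add: is_subfield_def diff_conv_add_uminus del: add_uminus_conv_diff)
  show "x / y \<in> k" if "x \<in> k" "y \<in> k"
    using assms that by (simp add: is_subfield_def divide_inverse)
qed

lemma sqrt5_square: "sqrt5 * sqrt5 = 5"
  by (simp flip: of_real_mult)

locale sqrt5_extension =
  fixes k :: "complex set"
  assumes subfield: "is_subfield k" and sqrt5: "sqrt5 \<notin> k"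
begin

lemmas closed = is_subfieldD[OF subfield]

lemma numeral_in: "numeral w \<in> k"
proof -
  have "of_nat j \<in> k" for j
    by (induction j) (auto intro: closed)
  from this[of "numeral w"] show ?thesis by simp
qed

lemma repr_unique:
  assumes "a \<in> k" "b \<in> k" "c \<in> k" "d \<in> k" "a + b * sqrt5 = c + d * sqrt5"
  shows "a = c \<and> b = d"
proof -
  have "b = d"
  proof (rule ccontr)
    assume "b \<noteq> d"
    then have "sqrt5 = (c - a) / (b - d)"
      using assms(5) by (simp add: field_simps)
    then show False
      using assms sqrt5 by (metis closed(7,8))
  qed
  with assms(5) show ?thesis by simp
qed

lemma conj5_eq:
  assumes "a \<in> k" "b \<in> k"
  shows "conj5 k (a + b * sqrt5) = a - b * sqrt5"
  unfolding conj5_def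
proof (rule the_equality)
  show "\<exists>a'\<in>k. \<exists>b'\<in>k. a + b * sqrt5 = a' + b' * sqrt5 \<and> a - b * sqrt5 = a' - b' * sqrt5"
    using assms by blast
next
  fix w assume "\<exists>a'\<in>k. \<exists>b'\<in>k. a + b * sqrt5 = a' + b' * sqrt5 \<and> w = a' - b' * sqrt5"
  then show "w = a - b * sqrt5"
    using repr_unique assms by blast
qed

lemma adjoin_sqrt5E:
  assumes "z \<in> adjoin_sqrt5 k"
  obtains a b where "a \<in> k" "b \<in> k" "z = a + b * sqrt5"
  using assms by (auto simp: adjoin_sqrt5_def)

lemma adjoin_sqrt5I: "a \<in> k \<Longrightarrow> b \<in> k \<Longrightarrow> a + b * sqrt5 \<in> adjoin_sqrt5 k"
  by (auto simp: adjoin_sqrt5_def)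

lemma adjoin_sqrt5_base: "a \<in> k \<Longrightarrow> a \<in> adjoin_sqrt5 k"
  using adjoin_sqrt5I[of a 0] closed(1) by simp

lemma sqrt5_in_adjoin: "sqrt5 \<in> adjoin_sqrt5 k"
  using adjoin_sqrt5I[of 0 1] closed(1,2) by simp

lemma mult_repr:
  "(a + b * sqrt5) * (c + d * sqrt5) = (a * c + 5 * (b * d)) + (a * d + b * c) * sqrt5"
  "(a - b * sqrt5) * (c - d * sqrt5) = (a * c + 5 * (b * d)) - (a * d + b * c) * sqrt5"
proof -
  have "(a + b * sqrt5) * (c + d * sqrt5)
      = a * c + (b * d) * (sqrt5 * sqrt5) + (a * d + b * c) * sqrt5"
    "(a - b * sqrt5) * (c - d * sqrt5)
      = a * c + (b * d) * (sqrt5 * sqrt5) - (a * d + b * c) * sqrt5"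
    by (simp_all only: algebra_simps)
  then show
    "(a + b * sqrt5) * (c + d * sqrt5) = (a * c + 5 * (b * d)) + (a * d + b * c) * sqrt5"
    "(a - b * sqrt5) * (c - d * sqrt5) = (a * c + 5 * (b * d)) - (a * d + b * c) * sqrt5"
    unfolding sqrt5_square by simp_all
qed

lemma
  assumes "z \<in> adjoin_sqrt5 k" "w \<in> adjoin_sqrt5 k"
  shows add_in: "z + w \<in> adjoin_sqrt5 k"
    and conj5_add: "conj5 k (z + w) = conj5 k z + conj5 k w"
    and mult_in: "z * w \<in> adjoin_sqrt5 k"
    and conj5_mult: "conj5 k (z * w) = conj5 k z * conj5 k w"
proof -
  obtain a b where z: "a \<in> k" "b \<in> k" "z = a + b * sqrt5"
    using assms(1) by (rule adjoin_sqrt5E)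
  obtain c d where w: "c \<in> k" "d \<in> k" "w = c + d * sqrt5"
    using assms(2) by (rule adjoin_sqrt5E)
  have s: "a + c \<in> k" "b + d \<in> k" and p: "a * c + 5 * (b * d) \<in> k" "a * d + b * c \<in> k"
    using z w by (auto intro!: closed numeral_in)
  have zw: "z + w = (a + c) + (b + d) * sqrt5"
    using z w by (simp add: algebra_simps)
  show "z + w \<in> adjoin_sqrt5 k"
    unfolding zw by (rule adjoin_sqrt5I[OF s])
  show "conj5 k (z + w) = conj5 k z + conj5 k w"
    unfolding zw conj5_eq[OF s] using z w by (simp add: conj5_eq algebra_simps)
  have zw: "z * w = (a * c + 5 * (b * d)) + (a * d + b * c) * sqrt5"
    unfolding z w by (rule mult_repr)
  show "z * w \<in> adjoin_sqrt5 k"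
    unfolding zw by (rule adjoin_sqrt5I[OF p])
  show "conj5 k (z * w) = conj5 k z * conj5 k w"
    unfolding zw conj5_eq[OF p] using z w by (simp add: conj5_eq mult_repr)
qed

lemma conj5_base: "a \<in> k \<Longrightarrow> conj5 k a = a"
  using conj5_eq[of a 0] closed(1) by simp

lemma conj5_sqrt5: "conj5 k sqrt5 = - sqrt5"
  using conj5_eq[of 0 1] closed(1,2) by simp

lemma conj5_0 [simp]: "conj5 k 0 = 0"
  by (simp add: conj5_base closed)

lemma conj5_in: "z \<in> adjoin_sqrt5 k \<Longrightarrow> conj5 k z \<in> adjoin_sqrt5 k"
  by (elim adjoin_sqrt5E) (use adjoin_sqrt5I closed(5) in \<open>force simp: conj5_eq\<close>)

lemma conj5_conj5: "z \<in> adjoin_sqrt5 k \<Longrightarrow> conj5 k (conj5 k z) = z"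
  using conj5_eq[OF _ closed(5)] by (elim adjoin_sqrt5E) (simp add: conj5_eq)

lemma trace_in: "z \<in> adjoin_sqrt5 k \<Longrightarrow> z + conj5 k z \<in> k"
  by (elim adjoin_sqrt5E) (auto simp: conj5_eq intro: closed numeral_in)

lemma norm5_eq: "a \<in> k \<Longrightarrow> b \<in> k \<Longrightarrow> norm5 k (a + b * sqrt5) = a\<^sup>2 - 5 * b\<^sup>2"
  by (simp add: norm5_def conj5_eq algebra_simps power2_eq_square)
     (simp add: sqrt5_square flip: mult.assoc)

lemma norm5_in: "z \<in> adjoin_sqrt5 k \<Longrightarrow> norm5 k z \<in> k"
  by (elim adjoin_sqrt5E) (auto simp: norm5_eq power2_eq_square intro!: closed numeral_in)

abbreviation "KX \<equiv> polys_over (adjoin_sqrt5 k)"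
abbreviation "cj \<equiv> map_poly (conj5 k)"

lemma coeff_cj [simp]: "coeff (cj p) i = conj5 k (coeff p i)"
  by (simp add: coeff_map_poly)

lemma sum_in: "(\<And>i. i \<in> A \<Longrightarrow> g i \<in> adjoin_sqrt5 k) \<Longrightarrow> sum g A \<in> adjoin_sqrt5 k"
  by (induction A rule: infinite_finite_induct) (auto intro: add_in adjoin_sqrt5_base closed)

lemma conj5_sum:
  "(\<And>i. i \<in> A \<Longrightarrow> g i \<in> adjoin_sqrt5 k) \<Longrightarrow> conj5 k (sum g A) = (\<Sum>i\<in>A. conj5 k (g i))"
  by (induction A rule: infinite_finite_induct) (auto simp: conj5_add sum_in)

lemma KX_add: "p \<in> KX \<Longrightarrow> q \<in> KX \<Longrightarrow> p + q \<in> KX \<and> cj (p + q) = cj p + cj q"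
  by (auto simp: polys_over_def poly_eq_iff add_in conj5_add)

lemma KX_mult: "p \<in> KX \<Longrightarrow> q \<in> KX \<Longrightarrow> p * q \<in> KX \<and> cj (p * q) = cj p * cj q"
  by (auto simp: polys_over_def poly_eq_iff coeff_mult conj5_sum conj5_mult mult_in sum_in)

lemma KX_const: "a \<in> adjoin_sqrt5 k \<Longrightarrow> [:a:] \<in> KX \<and> cj [:a:] = [:conj5 k a:]"
  by (auto simp: polys_over_def poly_eq_iff coeff_pCons adjoin_sqrt5_base closed split: nat.split)

lemma cj_eq_0_iff: "p \<in> KX \<Longrightarrow> cj p = 0 \<longleftrightarrow> p = 0"
  by (auto simp: polys_over_def poly_eq_iff) (metis conj5_conj5 conj5_0)

lemma rat_conj5_Fract:
  assumes "p \<in> KX" "q \<in> KX" "q \<noteq> 0"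
  shows "rat_conj5 k (Fract p q) = Fract (cj p) (cj q)"
  unfolding rat_conj5_def
proof (rule the_equality)
  show "\<exists>p' q'. p' \<in> KX \<and> q' \<in> KX \<and> q' \<noteq> 0 \<and> Fract p q = Fract p' q' \<and>
      Fract (cj p) (cj q) = Fract (cj p') (cj q')"
    using assms by blast
next
  fix s assume "\<exists>p' q'. p' \<in> KX \<and> q' \<in> KX \<and> q' \<noteq> 0 \<and> Fract p q = Fract p' q' \<and>
      s = Fract (cj p') (cj q')"
  then obtain p' q' where *: "p' \<in> KX" "q' \<in> KX" "q' \<noteq> 0" "Fract p q = Fract p' q'"
      "s = Fract (cj p') (cj q')" by blast
  then have "p * q' = p' * q"
    using assms by (simp add: eq_fract)
  then have "cj (p * q') = cj (p' * q)" by simp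
  then have "cj p * cj q' = cj p' * cj q"
    using assms * by (simp add: KX_mult)
  then show "s = Fract (cj p) (cj q)"
    using assms * by (simp add: eq_fract cj_eq_0_iff)
qed

end


section \<open>The Weierstrass model\<close>

definition const_rat :: "complex \<Rightarrow> complex poly fract" where
  "const_rat c = to_fract [:c:]"

definition weierstrass_rhs :: "complex set \<Rightarrow> complex \<Rightarrow> complex \<Rightarrow> complex poly fract" where
  "weierstrass_rhs k \<mu> \<eta> =
    (let t = to_fract [:1, - sqrt5:] / to_fract [:1, sqrt5:]; N = norm5 k \<mu> in
      rat_trace5 k (const_rat (\<mu>^2 * \<eta>^3) * t^3 - const_rat (2 * N * \<mu> * \<eta>^2) * t^2
                    - const_rat (5 * N * (N - 5)))
      * to_fract ([:1, 0, -5:]^3))"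

text \<open>
  The Weierstrass equation \<open>y\<^sup>2 = f(x)\<close>, with \<open>f\<close> viewed as a binary sextic, defines a genus 2 curve:
  there are six distinct branch points, one of them at infinity when the degree is 5.
\<close>

definition genus2_weierstrass :: "complex poly \<Rightarrow> bool" where
  "genus2_weierstrass f \<longleftrightarrow> degree f \<in> {5, 6} \<and> squarefree f"

lemma (in sqrt5_extension) weierstrass_rhs_polynomial:
  assumes "\<mu> \<in> adjoin_sqrt5 k" "\<eta> \<in> adjoin_sqrt5 k"
  shows "\<exists>!f. to_fract f = weierstrass_rhs k \<mu> \<eta>"
    and "to_fract f = weierstrass_rhs k \<mu> \<eta> \<Longrightarrow> f \<in> polys_over k \<and> degree f \<le> 6"
proof -
  define P Q :: "complex poly" where "P = [:1, - sqrt5:]" and "Q = [:1, sqrt5:]"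
  define u v w where "u = \<mu>^2 * \<eta>^3" and "v = - (2 * norm5 k \<mu> * \<mu> * \<eta>^2)"
    and "w = - (5 * norm5 k \<mu> * (norm5 k \<mu> - 5))"
  define R where "R = [:u:] * (P*P*P) + [:v:] * (P*P*Q) + [:w:] * (Q*Q*Q)"
  have PQ: "P \<noteq> 0" "Q \<noteq> 0" "[:1, 0, -5:] = P * Q"
    by (auto simp: P_def Q_def simp flip: of_real_mult)
  have neg: "z \<in> adjoin_sqrt5 k \<Longrightarrow> - z \<in> adjoin_sqrt5 k" for z
    using mult_in[OF adjoin_sqrt5_base[of "-1"], of z] closed by simp
  have N: "norm5 k \<mu> \<in> k" using assms by (simp add: norm5_in)
  have K: "u \<in> adjoin_sqrt5 k" "v \<in> adjoin_sqrt5 k" "w \<in> adjoin_sqrt5 k"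
    unfolding u_def v_def w_def power2_eq_square power3_eq_cube using assms N
    by (auto intro!: mult_in neg adjoin_sqrt5_base[of "norm5 k \<mu> - 5"]
             intro: adjoin_sqrt5_base numeral_in closed)
  have lin: "P \<in> KX" "cj P = Q" "Q \<in> KX" "cj Q = P"
    using neg[OF sqrt5_in_adjoin] sqrt5_in_adjoin adjoin_sqrt5_base[OF closed(1)]
      adjoin_sqrt5_base[OF closed(2)] conj5_mult[OF adjoin_sqrt5_base[of "-1"] sqrt5_in_adjoin]
      closed(2,5)
    by (auto simp: P_def Q_def polys_over_def poly_eq_iff coeff_pCons conj5_base conj5_sqrt5
             split: nat.split)
  have R: "R \<in> KX" unfolding R_def using K lin by (simp add: KX_add KX_mult KX_const del: mult_pCons_left)
  define g where "g = R * (P*P*P)"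
  have g: "g \<in> KX" "cj g = cj R * (Q*Q*Q)"
    unfolding g_def using R lin by (simp_all add: KX_mult)
  let ?F = "to_fract :: complex poly \<Rightarrow> _"
  have FQ: "?F Q \<noteq> 0" "?F P \<noteq> 0" using PQ by auto
  have Q3: "Q*Q*Q \<in> KX" "cj (Q*Q*Q) = P*P*P" "Q*Q*Q \<noteq> 0"
    using lin PQ by (simp_all add: KX_mult)
  have "rat_conj5 k (?F R / ?F (Q*Q*Q)) = ?F (cj R) / ?F (P*P*P)"
    using rat_conj5_Fract[OF R Q3(1,3)] Q3(2) by (simp add: Fract_conv_to_fract)
  moreover have "const_rat (\<mu>^2 * \<eta>^3) * (?F P / ?F Q)^3
      - const_rat (2 * norm5 k \<mu> * \<mu> * \<eta>^2) * (?F P / ?F Q)^2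
      - const_rat (5 * norm5 k \<mu> * (norm5 k \<mu> - 5)) = ?F R / ?F (Q*Q*Q)"
  proof -
    have c: "const_rat (\<mu>^2 * \<eta>^3) = ?F [:u:]"
      "const_rat (2 * norm5 k \<mu> * \<mu> * \<eta>^2) = - ?F [:v:]"
      "const_rat (5 * norm5 k \<mu> * (norm5 k \<mu> - 5)) = - ?F [:w:]"
      by (simp_all add: const_rat_def u_def v_def w_def flip: to_fract_uminus)
    show ?thesis
      unfolding c R_def to_fract_add to_fract_mult using FQ
      by (simp add: field_simps power2_eq_square power3_eq_cube)
  qed
  ultimately have rhs: "weierstrass_rhs k \<mu> \<eta>
      = (?F R / ?F (Q*Q*Q) + ?F (cj R) / ?F (P*P*P)) * ?F ((P * Q)^3)"
    unfolding weierstrass_rhs_def rat_trace5_def Let_def PQ(3) P_def[symmetric] Q_def[symmetric]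
    by simp
  have main: "weierstrass_rhs k \<mu> \<eta> = ?F (g + cj g)"
    unfolding rhs g(2) unfolding g_def to_fract_add to_fract_mult power3_eq_cube using FQ
    by (simp add: field_simps)
  then show "\<exists>!f. ?F f = weierstrass_rhs k \<mu> \<eta>"
    by (metis to_fract_eq_iff)
  have "degree (p * q) \<le> i + j" if "degree p \<le> i" "degree q \<le> j" for p q :: "complex poly" and i j
    using that degree_mult_le[of p q] by linarith
  note dm = this
  have d1: "degree P \<le> 1" "degree Q \<le> 1" by (auto simp: P_def Q_def)
  have d3: "degree (X*Y*Z) \<le> 3" if "degree X \<le> 1" "degree Y \<le> 1" "degree Z \<le> 1"
    for X Y Z :: "complex poly"
    using dm[OF dm[OF that(1,2)] that(3)] by simp
  have "degree R \<le> 3"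
    unfolding R_def
    by (intro degree_add_le dm[of "[:_:]" 0 _ 3, unfolded add_0_left] d3 d1) auto
  then have "degree g \<le> 6"
    unfolding g_def using dm[OF _ d3[OF d1(1) d1(1) d1(1)], of R 3] by simp
  moreover have "degree (cj g) \<le> degree g" by (rule map_poly_degree_leq)
  ultimately have "degree (g + cj g) \<le> 6" by (intro degree_add_le) auto
  moreover have "g + cj g \<in> polys_over k"
    using g(1) by (auto simp: polys_over_def trace_in)
  ultimately show "f \<in> polys_over k \<and> degree f \<le> 6" if "?F f = weierstrass_rhs k \<mu> \<eta>"
    using that unfolding main to_fract_eq_iff by simp
qed


section \<open>Igusa-Clebsch invariants\<close>

text \<open>
  The root formulas are stated for the binary sextic \<open>F(X, Z) = a l\<^sub>1 \<cdots> l\<^sub>6\<close> with linear forms \<open>l\<^sub>i\<close>,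
  where \<open>(ij)\<close> is the determinant of \<open>l\<^sub>i\<close> and \<open>l\<^sub>j\<close>. A polynomial \<open>q + p x\<close> of degree at most 1 stands
  for the form \<open>p X + q Z\<close>, so that \<open>[:1:]\<close> is the form \<open>Z\<close> vanishing at infinity. If \<open>f\<close> has degree 6,
  \<open>a\<close> is its leading coefficient and \<open>l\<^sub>i = x - x\<^sub>i\<close>, then \<open>(ij) = x\<^sub>i - x\<^sub>j\<close>; since each form occurs
  in every term of \<open>I\<^sub>d\<close> with exponent \<open>d\<close>, the value of \<open>I\<^sub>d\<close> is independent of the chosen
  factorization (see \<open>igusa_clebsch_eq\<close> and \<open>igusa_clebsch_degree_6\<close>), and this is the extension of the
  invariants, as polynomials in the coefficients, to vanishing \<open>x\<^sup>6\<close>-coefficient.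
\<close>

definition bracket :: "complex poly \<Rightarrow> complex poly \<Rightarrow> complex" where
  "bracket l l' = coeff l 1 * coeff l' 0 - coeff l 0 * coeff l' 1"

text \<open>
  A sum over all 720 permutations counts each of the 15, 10 and 60 distinct terms
  of \<open>I\<^sub>2\<close>, \<open>I\<^sub>4\<close>, \<open>I\<^sub>6\<close> exactly 48, 72 and 12 times.
\<close>

definition igusa_clebsch_formula :: "(nat \<Rightarrow> nat \<Rightarrow> complex) \<Rightarrow> complex \<Rightarrow> complex \<times> complex \<times> complex \<times> complex" where
  "igusa_clebsch_formula d a =
    (let S = {\<pi>. \<pi> permutes {1..6}} in
     (a^2 * (\<Sum>\<pi>\<in>S. (d (\<pi> 1) (\<pi> 2))^2 * (d (\<pi> 3) (\<pi> 4))^2 * (d (\<pi> 5) (\<pi> 6))^2) / 48,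
      a^4 * (\<Sum>\<pi>\<in>S. (d (\<pi> 1) (\<pi> 2))^2 * (d (\<pi> 2) (\<pi> 3))^2 * (d (\<pi> 3) (\<pi> 1))^2
                 * (d (\<pi> 4) (\<pi> 5))^2 * (d (\<pi> 5) (\<pi> 6))^2 * (d (\<pi> 6) (\<pi> 4))^2) / 72,
      a^6 * (\<Sum>\<pi>\<in>S. (d (\<pi> 1) (\<pi> 2))^2 * (d (\<pi> 2) (\<pi> 3))^2 * (d (\<pi> 3) (\<pi> 1))^2
                 * (d (\<pi> 4) (\<pi> 5))^2 * (d (\<pi> 5) (\<pi> 6))^2 * (d (\<pi> 6) (\<pi> 4))^2
                 * (d (\<pi> 1) (\<pi> 4))^2 * (d (\<pi> 2) (\<pi> 5))^2 * (d (\<pi> 3) (\<pi> 6))^2) / 12,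
      a^10 * (\<Prod>(i, j)\<in>{(i, j). 1 \<le> i \<and> i < j \<and> j \<le> 6}. (d i j)^2)))"

definition splits_sextic :: "complex poly \<Rightarrow> complex \<Rightarrow> (nat \<Rightarrow> complex poly) \<Rightarrow> bool" where
  "splits_sextic f a l \<longleftrightarrow> (\<forall>i\<in>{1..6}. degree (l i) \<le> 1) \<and> f = smult a (\<Prod>i\<in>{1..6}. l i)"

definition igusa_clebsch :: "complex poly \<Rightarrow> complex \<times> complex \<times> complex \<times> complex" where
  "igusa_clebsch f =
    (THE I. \<exists>a l. splits_sextic f a l \<and> I = igusa_clebsch_formula (\<lambda>i j. bracket (l i) (l j)) a)"

text \<open>
  Both tuples are nonzero and represent the same point of the weighted projective 3-space with
  weights 1, 2, 3, 5.
\<close>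

fun same_weighted_point ::
    "complex \<times> complex \<times> complex \<times> complex \<Rightarrow> complex \<times> complex \<times> complex \<times> complex \<Rightarrow> bool" where
  "same_weighted_point (a, b, c, d) (a', b', c', d') \<longleftrightarrow>
     (a, b, c, d) \<noteq> (0, 0, 0, 0) \<and>
     (\<exists>r. r \<noteq> 0 \<and> a' = r * a \<and> b' = r^2 * b \<and> c' = r^3 * c \<and> d' = r^5 * d)"

lemma splits_sextic_exists:
  assumes "degree f \<le> 6"
  obtains a l where "splits_sextic f a l"
proof -
  obtain r where r: "smult (lead_coeff f) (\<Prod>i<degree f. [:- r i, 1:]) = f"
    by (rule complex_poly_decompose')
  define l where "l i = (if i \<le> degree f then [:- r (i - 1), 1:] else 1)" for i :: nat
  have "(\<Prod>i\<in>{1..6}. l i) = (\<Prod>i\<in>{1..degree f}. l i)"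
    using assms by (intro prod.mono_neutral_right) (auto simp: l_def)
  also have "\<dots> = (\<Prod>i<degree f. [:- r i, 1:])"
    by (rule prod.reindex_bij_witness[of _ Suc "\<lambda>i. i - 1"]) (auto simp: l_def)
  finally have "splits_sextic f (lead_coeff f) l"
    using r by (auto simp: splits_sextic_def l_def)
  then show thesis by (rule that)
qed

lemma prod_six: "(\<Prod>i\<in>{1..6::nat}. g i) = g 1 * g 2 * g 3 * g 4 * g 5 * (g 6 :: 'a :: comm_monoid_mult)"
  by (simp add: numeral_eq_Suc atLeastAtMostSuc_conv mult_ac)

lemma prod_pairs_permute:
  fixes h :: "nat \<Rightarrow> nat \<Rightarrow> complex"
  assumes sym: "\<And>i j. h i j = h j i" and p: "p permutes {1..6}"
  shows "(\<Prod>(i, j)\<in>{(i, j). 1 \<le> i \<and> i < j \<and> j \<le> 6}. h (p i) (p j))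
       = (\<Prod>(i, j)\<in>{(i, j). 1 \<le> i \<and> i < j \<and> j \<le> 6}. h i j)"
proof -
  define s where "s q = (\<lambda>(i, j). (min (q i) (q j), max (q i) (q j)))" for q :: "nat \<Rightarrow> nat"
  have q: "inv p permutes {1..6}" "inv p (p i) = i" "p (inv p i) = i" for i
    using p by (auto simp: permutes_inv permutes_inverses)
  have inj: "p i = p j \<longleftrightarrow> i = j" "inv p i = inv p j \<longleftrightarrow> i = j" for i j
    using q by metis+
  have img: "1 \<le> p i \<and> p i \<le> 6 \<longleftrightarrow> 1 \<le> i \<and> i \<le> 6" "1 \<le> inv p i \<and> inv p i \<le> 6 \<longleftrightarrow> 1 \<le> i \<and> i \<le> 6" for i
    using permutes_in_image[OF p, of i] permutes_in_image[OF q(1), of i] by auto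
  show ?thesis
  proof (rule prod.reindex_bij_witness[of _ "s (inv p)" "s p"], goal_cases)
    case (1 x) then show ?case by (auto simp: s_def min_def max_def q)
  next
    case (2 x) 
    then obtain i j where x: "x = (i, j)" "1 \<le> i" "i < j" "j \<le> 6" by auto
    then show ?case
      using img(1)[of i] img(1)[of j] inj(1)[of i j] by (auto simp: s_def min_def max_def)
  next
    case (3 x) then show ?case by (auto simp: s_def min_def max_def q)
  next
    case (4 x)
    then obtain i j where x: "x = (i, j)" "1 \<le> i" "i < j" "j \<le> 6" by auto
    then show ?case
      using img(2)[of i] img(2)[of j] inj(2)[of i j] by (auto simp: s_def min_def max_def)
  next
    case (5 x) then show ?case by (auto simp: s_def min_def max_def sym)
  qed
qed

lemma igusa_clebsch_formula_rescale:
  assumes p: "p permutes {1..6}"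
    and d: "\<And>i j. i \<in> {1..6} \<Longrightarrow> j \<in> {1..6} \<Longrightarrow> d i j = c i * c j * d' (p i) (p j)"
    and sym: "\<And>i j. (d' i j)^2 = (d' j i)^2"
    and a': "a' = a * (\<Prod>i\<in>{1..6}. c i)"
  shows "igusa_clebsch_formula d a = igusa_clebsch_formula d' a'"
proof -
  define C where "C = (\<Prod>i\<in>{1..6}. c i)"
  let ?S = "{\<pi>. \<pi> permutes {1..6::nat}}"
  have C: "C = c (\<pi> 1) * c (\<pi> 2) * c (\<pi> 3) * c (\<pi> 4) * c (\<pi> 5) * c (\<pi> 6)" if "\<pi> \<in> ?S" for \<pi>
    using prod.permute[of \<pi> "{1..6}" c] that unfolding C_def prod_six o_def by simp
  have D: "d (\<pi> i) (\<pi> j) = c (\<pi> i) * c (\<pi> j) * d' ((p \<circ> \<pi>) i) ((p \<circ> \<pi>) j)"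
    if "\<pi> \<in> ?S" "i \<in> {1..6}" "j \<in> {1..6}" for \<pi> i j
    using that d permutes_in_image[of \<pi> "{1..6}"] by (simp del: atLeastAtMost_iff)
  have one_to_six: "1 \<in> {1..6::nat}" "2 \<in> {1..6::nat}" "3 \<in> {1..6::nat}"
    "4 \<in> {1..6::nat}" "5 \<in> {1..6::nat}" "6 \<in> {1..6::nat}" by simp_all
  have pow: "x^4 = x^2 * x^2" "x^6 = x^2 * x^2 * x^2" "x^10 = x^2 * x^2 * x^2 * x^2 * x^2" for x :: complex
    by (simp_all flip: power_add)
  have sum: "(\<Sum>\<pi>\<in>?S. G \<pi>) = C^n * (\<Sum>\<pi>\<in>?S. G' \<pi>)"
    if "\<And>\<pi>. \<pi> \<in> ?S \<Longrightarrow> G \<pi> = C^n * G' (p \<circ> \<pi>)" for G G' :: "(nat \<Rightarrow> nat) \<Rightarrow> complex" and n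
  proof -
    have "(\<Sum>\<pi>\<in>?S. G \<pi>) = (\<Sum>\<pi>\<in>?S. C^n * G' (p \<circ> \<pi>))"
      using that by (intro sum.cong) auto
    also have "\<dots> = (\<Sum>\<pi>\<in>?S. C^n * G' \<pi>)"
      by (rule setum_permutations_compose_left[OF p, symmetric])
    finally show ?thesis by (simp add: sum_distrib_left)
  qed
  let ?E = "{(i, j). 1 \<le> i \<and> i < j \<and> j \<le> (6::nat)}"
  have E: "?E = {(1,2),(1,3),(1,4),(1,5),(1,6),(2,3),(2,4),(2,5),(2,6),(3,4),(3,5),(3,6),(4,5),(4,6),(5,6)}"
    (is "_ = ?E'")
  proof (intro set_eqI iffI)
    have six: "{1..6::nat} = {1,2,3,4,5,6}"
      by (simp add: numeral_eq_Suc atLeastAtMostSuc_conv insert_commute)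
    fix x assume "x \<in> ?E"
    then obtain i j where x: "x = (i, j)" "1 \<le> i" "i < j" "j \<le> 6" by blast
    then have "i \<in> {1..6}" "j \<in> {1..6}" by simp_all
    then have "i \<in> {1,2,3,4,5,6}" "j \<in> {1,2,3,4,5,6}" unfolding six .
    with x(3) have "(i, j) \<in> ?E'"
      by (elim insertE emptyE; simp)
    with x(1) show "x \<in> ?E'" by simp
  qed auto
  have "(\<Prod>(i, j)\<in>?E. (d i j)^2) = (\<Prod>(i, j)\<in>?E. (c i * c j)^2 * (d' (p i) (p j))^2)"
    by (intro prod.cong) (auto simp: d power_mult_distrib)
  also have "\<dots> = (\<Prod>(i, j)\<in>?E. (c i * c j)^2) * (\<Prod>(i, j)\<in>?E. (d' (p i) (p j))^2)"
    by (simp add: prod.distrib case_prod_unfold)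
  also have "(\<Prod>(i, j)\<in>?E. (d' (p i) (p j))^2) = (\<Prod>(i, j)\<in>?E. (d' i j)^2)"
    by (rule prod_pairs_permute[of "\<lambda>i j. (d' i j)^2", OF sym p])
  also have "(\<Prod>(i, j)\<in>?E. (c i * c j)^2) = C^10"
  proof -
    have "(\<Prod>(i, j)\<in>?E. (c i * c j)^2) =
      (c 1 * c 2)^2 * (c 1 * c 3)^2 * (c 1 * c 4)^2 * (c 1 * c 5)^2 * (c 1 * c 6)^2
      * (c 2 * c 3)^2 * (c 2 * c 4)^2 * (c 2 * c 5)^2 * (c 2 * c 6)^2 * (c 3 * c 4)^2
      * (c 3 * c 5)^2 * (c 3 * c 6)^2 * (c 4 * c 5)^2 * (c 4 * c 6)^2 * (c 5 * c 6)^2"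
      unfolding E by (simp add: mult.assoc)
    also have "\<dots> = C^10"
      unfolding C_def prod_six by (simp only: pow power_mult_distrib mult_ac)
    finally show ?thesis .
  qed
  finally have disc: "(\<Prod>(i, j)\<in>?E. (d i j)^2) = C^10 * (\<Prod>(i, j)\<in>?E. (d' i j)^2)" .
  have 2: "(\<Sum>\<pi>\<in>?S. (d (\<pi> 1) (\<pi> 2))^2 * (d (\<pi> 3) (\<pi> 4))^2 * (d (\<pi> 5) (\<pi> 6))^2)
    = C^2 * (\<Sum>\<pi>\<in>?S. (d' (\<pi> 1) (\<pi> 2))^2 * (d' (\<pi> 3) (\<pi> 4))^2 * (d' (\<pi> 5) (\<pi> 6))^2)"
  proof (rule sum, goal_cases)
    case (1 \<pi>)
    show ?case by (simp only: D[OF 1] C[OF 1] one_to_six) (simp only: power_mult_distrib mult_ac)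
  qed
  have 4: "(\<Sum>\<pi>\<in>?S. (d (\<pi> 1) (\<pi> 2))^2 * (d (\<pi> 2) (\<pi> 3))^2 * (d (\<pi> 3) (\<pi> 1))^2
                 * (d (\<pi> 4) (\<pi> 5))^2 * (d (\<pi> 5) (\<pi> 6))^2 * (d (\<pi> 6) (\<pi> 4))^2)
    = C^4 * (\<Sum>\<pi>\<in>?S. (d' (\<pi> 1) (\<pi> 2))^2 * (d' (\<pi> 2) (\<pi> 3))^2 * (d' (\<pi> 3) (\<pi> 1))^2
                 * (d' (\<pi> 4) (\<pi> 5))^2 * (d' (\<pi> 5) (\<pi> 6))^2 * (d' (\<pi> 6) (\<pi> 4))^2)"
  proof (rule sum, goal_cases)
    case (1 \<pi>)
    show ?case by (simp only: D[OF 1] C[OF 1] one_to_six) (simp only: pow power_mult_distrib mult_ac)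
  qed
  have 6: "(\<Sum>\<pi>\<in>?S. (d (\<pi> 1) (\<pi> 2))^2 * (d (\<pi> 2) (\<pi> 3))^2 * (d (\<pi> 3) (\<pi> 1))^2
                 * (d (\<pi> 4) (\<pi> 5))^2 * (d (\<pi> 5) (\<pi> 6))^2 * (d (\<pi> 6) (\<pi> 4))^2
                 * (d (\<pi> 1) (\<pi> 4))^2 * (d (\<pi> 2) (\<pi> 5))^2 * (d (\<pi> 3) (\<pi> 6))^2)
    = C^6 * (\<Sum>\<pi>\<in>?S. (d' (\<pi> 1) (\<pi> 2))^2 * (d' (\<pi> 2) (\<pi> 3))^2 * (d' (\<pi> 3) (\<pi> 1))^2
                 * (d' (\<pi> 4) (\<pi> 5))^2 * (d' (\<pi> 5) (\<pi> 6))^2 * (d' (\<pi> 6) (\<pi> 4))^2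
                 * (d' (\<pi> 1) (\<pi> 4))^2 * (d' (\<pi> 2) (\<pi> 5))^2 * (d' (\<pi> 3) (\<pi> 6))^2)"
  proof (rule sum, goal_cases)
    case (1 \<pi>)
    show ?case by (simp only: D[OF 1] C[OF 1] one_to_six) (simp only: pow power_mult_distrib mult_ac)
  qed
  show ?thesis
    unfolding igusa_clebsch_formula_def Let_def 2 4 6 disc a' C_def[symmetric]
    by (simp only: power_mult_distrib mult.assoc)
qed

lemma bracket_0 [simp]: "bracket 0 l = 0" "bracket l 0 = 0"
  by (simp_all add: bracket_def)

lemma bracket_smult: "bracket (smult b l) (smult c l') = b * c * bracket l l'"
  by (simp add: bracket_def algebra_simps)

lemma igusa_clebsch_formula_zero:
  assumes "a = 0 \<or> (\<exists>i\<in>{1..6}. l i = 0)"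
  shows "igusa_clebsch_formula (\<lambda>i j. bracket (l i) (l j)) a = (0, 0, 0, 0)"
proof (cases "a = 0")
  case True
  then show ?thesis by (simp add: igusa_clebsch_formula_def)
next
  case False
  then obtain i where i: "i \<in> {1..6}" "l i = 0" using assms by blast
  define c where "c j = (if j = i then 0 else (1 :: complex))" for j
  have "l j = smult (c j) (l j)" for j using i by (simp add: c_def)
  then have "bracket (l j) (l k) = c j * c k * bracket (l j) (l k)" for j k
    by (metis bracket_smult)
  moreover have "(\<Prod>j\<in>{1..6}. c j) = 0" using i by (auto simp: c_def)
  ultimately have "igusa_clebsch_formula (\<lambda>i j. bracket (l i) (l j)) a
      = igusa_clebsch_formula (\<lambda>i j. bracket (l i) (l j)) 0"
    by (intro igusa_clebsch_formula_rescale[where p = id and c = c])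
       (auto simp: permutes_id bracket_def power2_commute mult.commute)
  then show ?thesis by (simp add: igusa_clebsch_formula_def)
qed

lemma splits_sextic_unique:
  assumes "splits_sextic f a l" "splits_sextic f a' l'"
  shows "igusa_clebsch_formula (\<lambda>i j. bracket (l i) (l j)) a
       = igusa_clebsch_formula (\<lambda>i j. bracket (l' i) (l' j)) a'"
proof (cases "f = 0")
  case True
  then have "a = 0 \<or> (\<exists>i\<in>{1..6}. l i = 0)" "a' = 0 \<or> (\<exists>i\<in>{1..6}. l' i = 0)"
    using assms by (auto simp: splits_sextic_def)
  then show ?thesis by (simp add: igusa_clebsch_formula_zero)
next
  case False
  define pt where "pt p = (if degree p = 1 then Some (- coeff p 0 / coeff p 1) else None)"
    for p :: "complex poly"
  have lin: "p = [:coeff p 0, coeff p 1:]" if "degree p \<le> 1" for p :: "complex poly"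
    using that by (intro poly_eqI) (auto simp: coeff_pCons coeff_eq_0 split: nat.split)
  have pt_lin: "\<exists>c. c \<noteq> 0 \<and> p = smult c (case pt p of None \<Rightarrow> 1 | Some r \<Rightarrow> [:- r, 1:])"
    if p: "degree p \<le> 1" "p \<noteq> 0" for p :: "complex poly"
  proof (cases "degree p = 1")
    case True
    then have "coeff p 1 \<noteq> 0" using p(2) leading_coeff_0_iff[of p] by auto
    then show ?thesis
      using True lin[OF p(1)] by (intro exI[of _ "coeff p 1"]) (auto simp: pt_def)
  next
    case False
    then have "degree p = 0" using p(1) by simp
    then obtain b where "p = [:b:]" by (rule degree_eq_zeroE)
    then show ?thesis
      using p(2) by (intro exI[of _ b]) (auto simp: pt_def)
  qed
  have ord: "order r p = (if pt p = Some r then 1 else 0)" if p: "degree p \<le> 1" "p \<noteq> 0" for p :: "complex poly" and r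
  proof -
    obtain c where c: "c \<noteq> 0" "p = smult c (case pt p of None \<Rightarrow> 1 | Some r \<Rightarrow> [:- r, 1:])"
      using pt_lin[OF p] by blast
    have "order r p = order r (case pt p of None \<Rightarrow> 1 | Some r \<Rightarrow> [:- r, 1:])"
      using c by (metis order_smult)
    also have "\<dots> = (if pt p = Some r then 1 else 0)"
      using order_power_n_n[of r 1] by (auto split: option.split intro!: order_0I)
    finally show ?thesis .
  qed
  have count: "count (image_mset (\<lambda>i. pt (m i)) (mset_set {1..6::nat})) x =
      (case x of None \<Rightarrow> 6 - degree f | Some r \<Rightarrow> order r f)"
    if m: "splits_sextic f b m" for b m x
  proof -
    have nz: "b \<noteq> 0" "\<And>i. i \<in> {1..6} \<Longrightarrow> m i \<noteq> 0" and deg: "\<And>i. i \<in> {1..6} \<Longrightarrow> degree (m i) \<le> 1"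
      and f: "f = smult b (\<Prod>i\<in>{1..6}. m i)"
      using m False by (auto simp: splits_sextic_def)
    have cnt: "count (image_mset h (mset_set A)) x = (\<Sum>i\<in>A. if h i = x then 1 else 0)"
      if "finite A" for h :: "nat \<Rightarrow> complex option" and A
      using that by induction auto
    have prod_ord: "order r (\<Prod>i\<in>A. m i) = (\<Sum>i\<in>A. order r (m i))"
      if "finite A" "A \<subseteq> {1..6}" for r A
      using that
    proof induction
      case (insert y A)
      then have "m y * (\<Prod>i\<in>A. m i) \<noteq> 0" using nz(2) by (auto simp del: atLeastAtMost_iff)
      then show ?case using insert by (simp add: order_mult)
    qed auto
    show ?thesis
    proof (cases x)
      case (Some r)
      have "order r f = (\<Sum>i\<in>{1..6}. order r (m i))"
        using nz(1) unfolding f by (simp add: order_smult prod_ord del: atLeastAtMost_iff)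
      also have "\<dots> = (\<Sum>i\<in>{1..6}. if pt (m i) = x then 1 else 0)"
        using ord[OF deg nz(2)] Some by (intro sum.cong) auto
      finally show ?thesis using Some unfolding cnt[OF finite_atLeastAtMost] by simp
    next
      case None
      have "degree f = (\<Sum>i\<in>{1..6}. degree (m i))"
        using nz unfolding f by (simp add: degree_prod_eq_sum_degree del: atLeastAtMost_iff)
      moreover have "(\<Sum>i\<in>{1..6::nat}. if pt (m i) = x then 1 else 0) + (\<Sum>i\<in>{1..6}. degree (m i))
          = (\<Sum>i\<in>{1..6::nat}. 1)"
        unfolding sum.distrib[symmetric]
      proof (intro sum.cong refl)
        fix i :: nat assume "i \<in> {1..6}"
        from deg[OF this] show "(if pt (m i) = x then 1 else 0) + degree (m i) = 1"
          using None by (auto simp: pt_def)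
      qed
      ultimately show ?thesis using None unfolding cnt[OF finite_atLeastAtMost] by simp
    qed
  qed
  have "image_mset (\<lambda>i. pt (l i)) (mset_set {1..6}) = image_mset (\<lambda>i. pt (l' i)) (mset_set {1..6})"
    using count[OF assms(1)] count[OF assms(2)] by (intro multiset_eqI) simp
  then obtain p where p: "p permutes {1..6}" "\<forall>i\<in>{1..6}. pt (l i) = pt (l' (p i))"
    using image_mset_eq_implies_permutes[OF finite_atLeastAtMost] by blast
  have "\<exists>c. l i = smult c (l' (p i))" if i: "i \<in> {1..6}" for i
  proof -
    have pi: "p i \<in> {1..6}"
      using permutes_in_image[OF p(1)] i by blast
    have nz: "m j \<noteq> 0" if "splits_sextic f b m" "j \<in> {1..6}" for b m j
      using that False prod_zero[of "{1..6}" m] by (auto simp: splits_sextic_def)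
    have deg: "degree (l i) \<le> 1" "degree (l' (p i)) \<le> 1"
      using assms i pi by (auto simp: splits_sextic_def)
    obtain b c where
      b: "l i = smult b (case pt (l i) of None \<Rightarrow> 1 | Some r \<Rightarrow> [:- r, 1:])" and
      c: "c \<noteq> 0" "l' (p i) = smult c (case pt (l' (p i)) of None \<Rightarrow> 1 | Some r \<Rightarrow> [:- r, 1:])"
      using pt_lin[OF deg(1) nz[OF assms(1) i]] pt_lin[OF deg(2) nz[OF assms(2) pi]] by blast
    have "pt (l' (p i)) = pt (l i)" using p(2) i by simp
    note c' = c(2)[unfolded this]
    have "smult (b / c) (l' (p i)) = smult b (case pt (l i) of None \<Rightarrow> 1 | Some r \<Rightarrow> [:- r, 1:])"
      by (subst c') (use c(1) in simp)
    with b have "l i = smult (b / c) (l' (p i))" by (rule trans[OF _ sym])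
    then show ?thesis by blast
  qed
  then obtain c where c: "\<And>i. i \<in> {1..6} \<Longrightarrow> l i = smult (c i) (l' (p i))"
    by metis
  have "f = smult a (\<Prod>i\<in>{1..6}. smult (c i) (l' (p i)))"
    using assms(1) c by (simp add: splits_sextic_def)
  also have "\<dots> = smult (a * (\<Prod>i\<in>{1..6}. c i)) (\<Prod>i\<in>{1..6}. l' (p i))"
    by (simp add: prod_smult)
  also have "(\<Prod>i\<in>{1..6}. l' (p i)) = (\<Prod>i\<in>{1..6}. l' i)"
    using prod.permute[OF p(1), of l'] by (simp add: o_def)
  finally have f: "f = smult (a * (\<Prod>i\<in>{1..6}. c i)) (\<Prod>i\<in>{1..6}. l' i)" .
  have f': "f = smult a' (\<Prod>i\<in>{1..6}. l' i)"
    using assms(2) by (simp add: splits_sextic_def)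
  have "smult (a' - a * (\<Prod>i\<in>{1..6}. c i)) (\<Prod>i\<in>{1..6}. l' i) = f - f"
    unfolding smult_diff_left by (subst (1) f', subst (1) f) (rule refl)
  moreover have "(\<Prod>i\<in>{1..6}. l' i) \<noteq> 0" using False f' by auto
  ultimately have a': "a' = a * (\<Prod>i\<in>{1..6}. c i)" by simp
  show ?thesis
  proof (rule igusa_clebsch_formula_rescale[OF p(1) _ _ a'])
    show "bracket (l i) (l j) = c i * c j * bracket (l' (p i)) (l' (p j))"
      if "i \<in> {1..6}" "j \<in> {1..6}" for i j
      unfolding c[OF that(1)] c[OF that(2)] by (rule bracket_smult)
    show "(bracket (l' i) (l' j))^2 = (bracket (l' j) (l' i))^2" for i j
      by (simp add: bracket_def power2_commute mult.commute)
  qed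
qed

lemma igusa_clebsch_eq:
  assumes "splits_sextic f a l"
  shows "igusa_clebsch f = igusa_clebsch_formula (\<lambda>i j. bracket (l i) (l j)) a"
  unfolding igusa_clebsch_def using assms splits_sextic_unique by (intro the_equality) blast+

lemma igusa_clebsch_degree_6:
  assumes "f = smult a (\<Prod>i\<in>{1..6}. [:- x i, 1:])"
  shows "igusa_clebsch f = igusa_clebsch_formula (\<lambda>i j. x i - x j) a"
  using igusa_clebsch_eq[of f a "\<lambda>i. [:- x i, 1:]"] assms
  by (simp add: splits_sextic_def bracket_def)

end

theory Submission
  imports Defs
begin

text \<open>
  In the coordinates \<open>P = 1 - x\<surd>5\<close>, \<open>Q = 1 + x\<surd>5\<close> the right-hand side is the sparse sextic
  \<open>\<mu>\<^sup>2\<eta>\<^sup>3P\<^sup>6 - 2N\<mu>\<eta>\<^sup>2P\<^sup>5Q - 10N(N-5)P\<^sup>3Q\<^sup>3 - 2N\<mu>'\<eta>'\<^sup>2PQ\<^sup>5 + \<mu>'\<^sup>2\<eta>'\<^sup>3Q\<^sup>6\<close>, whose invariants in terms of the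
  coefficients depend only on \<open>\<mu>\<mu>' = \<nu>\<close>, \<open>\<mu> + \<mu>' = 2m\<close> and \<open>\<eta>\<eta>' = 5 - \<nu>\<close>; they are the stated
  ones up to the weighted factor \<open>10\<nu>\<^sup>2(5-\<nu>)\<^sup>2\<close>, and the coordinate change contributes the factor
  \<open>(2\<surd>5)\<^sup>6 = 8000\<close>. The expressions of the invariants in the roots and in the coefficients (by Clebsch's
  transvectants) are both unchanged under \<open>x \<mapsto> x + t\<close> and \<open>x \<mapsto> 1/x\<close>, so their equality need only be
  checked after moving one root to infinity and another one to 0, where it is a polynomial identity
  in the four remaining roots.
\<close>

section \<open>The root formulas as explicit sums\<close>

lemma one_to_six: "{1..6::nat} = {1, 2, 3, 4, 5, 6}"
  by (simp add: numeral_eq_Suc atLeastAtMostSuc_conv insert_commute)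

text \<open>The sum over the 15 perfect matchings of \<open>1..6\<close>, grouped by the partner of
  1. With squared brackets as \<open>w\<close>, it is \<open>I\<^sub>2\<close> without the factor
  \<open>a^2\<close>.\<close>

definition matchings_sum :: "(nat \<Rightarrow> nat \<Rightarrow> 'a :: comm_ring_1) \<Rightarrow> 'a" where
  "matchings_sum w =
     w 1 2 * (w 3 4 * w 5 6 + w 3 5 * w 4 6 + w 3 6 * w 4 5)
   + w 1 3 * (w 2 4 * w 5 6 + w 2 5 * w 4 6 + w 2 6 * w 4 5)
   + w 1 4 * (w 2 3 * w 5 6 + w 2 5 * w 3 6 + w 2 6 * w 3 5)
   + w 1 5 * (w 2 3 * w 4 6 + w 2 4 * w 3 6 + w 2 6 * w 3 4)
   + w 1 6 * (w 2 3 * w 4 5 + w 2 4 * w 3 5 + w 2 5 * w 3 4)"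

text \<open>The ten unordered splittings of \<open>1..6\<close> into two triples are listed with 1
  always in the first triple.\<close>

definition splittings_sum :: "(nat \<Rightarrow> nat \<Rightarrow> nat \<Rightarrow> nat \<Rightarrow> nat \<Rightarrow> nat \<Rightarrow> 'a :: comm_ring_1) \<Rightarrow> 'a" where
  "splittings_sum F =
     F 1 2 3 4 5 6 + F 1 2 4 3 5 6 + F 1 2 5 3 4 6 + F 1 2 6 3 4 5 + F 1 3 4 2 5 6
   + F 1 3 5 2 4 6 + F 1 3 6 2 4 5 + F 1 4 5 2 3 6 + F 1 4 6 2 3 5 + F 1 5 6 2 3 4"

definition triangles :: "(nat \<Rightarrow> nat \<Rightarrow> 'a :: comm_ring_1) \<Rightarrow> nat \<Rightarrow> nat \<Rightarrow> nat \<Rightarrow> nat \<Rightarrow> nat \<Rightarrow> nat \<Rightarrow> 'a" where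
  "triangles w i j k l m n = w i j * w i k * w j k * (w l m * w l n * w m n)"

text \<open>The second factor is the permanent of the matrix with rows \<open>i, j, k\<close> and columns \<open>l, m, n\<close>.\<close>

definition prisms :: "(nat \<Rightarrow> nat \<Rightarrow> 'a :: comm_ring_1) \<Rightarrow> nat \<Rightarrow> nat \<Rightarrow> nat \<Rightarrow> nat \<Rightarrow> nat \<Rightarrow> nat \<Rightarrow> 'a" where
  "prisms w i j k l m n = triangles w i j k l m n *
     (w i l * (w j m * w k n + w j n * w k m) + w i m * (w j l * w k n + w j n * w k l)
      + w i n * (w j l * w k m + w j m * w k l))"

text \<open>Cosets of the stabilizer of the smallest point, indexed by the image \<open>b\<close> of
  that point.\<close>

lemma sum_permutes_insert_six:
  fixes f :: "(nat \<Rightarrow> nat) \<Rightarrow> complex"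
  shows "(\<Sum>p | p permutes {1,2,3,4,5,6}. f p) = (\<Sum>b\<in>{1,2,3,4,5,6}. \<Sum>q | q permutes {2,3,4,5,6}. f (transpose 1 b \<circ> q))"
    "(\<Sum>p | p permutes {2,3,4,5,6}. f p) = (\<Sum>b\<in>{2,3,4,5,6}. \<Sum>q | q permutes {3,4,5,6}. f (transpose 2 b \<circ> q))"
    "(\<Sum>p | p permutes {3,4,5,6}. f p) = (\<Sum>b\<in>{3,4,5,6}. \<Sum>q | q permutes {4,5,6}. f (transpose 3 b \<circ> q))"
    by (rule sum_over_permutations_insert; simp)+

lemma sum_permutes_matchings:
  fixes w :: "nat \<Rightarrow> nat \<Rightarrow> complex"
  assumes sym: "\<And>i j. w i j = w j i"
  shows "(\<Sum>\<pi> | \<pi> permutes {1..6}. w (\<pi> 1) (\<pi> 2) * w (\<pi> 3) (\<pi> 4) * w (\<pi> 5) (\<pi> 6))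
    = 48 * matchings_sum w"
proof -
  note sym' = sym[of 2 1] sym[of 3 1] sym[of 3 2] sym[of 4 1] sym[of 4 2] sym[of 4 3]
    sym[of 5 1] sym[of 5 2] sym[of 5 3] sym[of 5 4]
    sym[of 6 1] sym[of 6 2] sym[of 6 3] sym[of 6 4] sym[of 6 5]
  \<comment> \<open>The 24 permutations of \<open>3, 4, 5, 6\<close> give each matching of the last
    four points 8 times. The 30 choices of \<open>a\<close> and \<open>b\<close> below fix the
    images of 1 and 2 and count each matching 6 times, whence 48.\<close>
  have inner: "(\<Sum>q | q permutes {3,4,5,6}. w (\<tau> (q 1)) (\<tau> (q 2)) * w (\<tau> (q 3)) (\<tau> (q 4)) * w (\<tau> (q 5)) (\<tau> (q 6)))
      = 8 * (w (\<tau> 1) (\<tau> 2) * (w (\<tau> 3) (\<tau> 4) * w (\<tau> 5) (\<tau> 6) + w (\<tau> 3) (\<tau> 5) * w (\<tau> 4) (\<tau> 6)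
         + w (\<tau> 3) (\<tau> 6) * w (\<tau> 4) (\<tau> 5)))" for \<tau> :: "nat \<Rightarrow> nat"
    by (simp add: sum_over_permutations_insert transpose_def del: One_nat_def)
       (simp add: sym[of "\<tau> 4" "\<tau> 3"] sym[of "\<tau> 5" "\<tau> 3"] sym[of "\<tau> 6" "\<tau> 3"]
         sym[of "\<tau> 5" "\<tau> 4"] sym[of "\<tau> 6" "\<tau> 4"] sym[of "\<tau> 6" "\<tau> 5"], algebra)
  let ?G = "\<lambda>\<tau>. w (\<tau> 1) (\<tau> 2) * w (\<tau> 3) (\<tau> 4) * w (\<tau> 5) (\<tau> 6)"
  let ?H = "\<lambda>\<tau>. w (\<tau> 1) (\<tau> 2) * (w (\<tau> 3) (\<tau> 4) * w (\<tau> 5) (\<tau> 6) + w (\<tau> 3) (\<tau> 5) * w (\<tau> 4) (\<tau> 6)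
         + w (\<tau> 3) (\<tau> 6) * w (\<tau> 4) (\<tau> 5))"
  have "(\<Sum>\<pi> | \<pi> permutes {1..6}. ?G \<pi>) =
    (\<Sum>a\<in>{1,2,3,4,5,6}. \<Sum>b\<in>{2,3,4,5,6}.
      \<Sum>q | q permutes {3,4,5,6}. ?G (transpose 1 a \<circ> (transpose 2 b \<circ> q)))"
    unfolding one_to_six by (simp only: sum_permutes_insert_six)
  also have "\<dots> = 8 * (\<Sum>a\<in>{1,2,3,4,5,6}. \<Sum>b\<in>{2,3,4,5,6}. ?H (transpose 1 a \<circ> transpose 2 b))"
    using inner[of "transpose 1 a \<circ> transpose 2 b" for a b]
    by (simp only: sum_distrib_left o_apply)
  also have "\<dots> = 48 * matchings_sum w"
    unfolding matchings_sum_def 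
    by (simp add: transpose_def del: One_nat_def) (simp only: sym', algebra)
  finally show ?thesis .
qed

text \<open>The symmetries \<open>sym\<close> generate the stabilizer of a splitting, of order 2 * 6
  * 6 = 72. Permuting \<open>4, 5, 6\<close> accounts for a factor 6, ordering the first triple and
  exchanging the triples for 12.\<close>

lemma sum_permutes_splittings:
  fixes F :: "nat \<Rightarrow> nat \<Rightarrow> nat \<Rightarrow> nat \<Rightarrow> nat \<Rightarrow> nat \<Rightarrow> complex"
  assumes sym: "\<And>i j k l m n. F i j k l m n = F j i k l m n"
    "\<And>i j k l m n. F i j k l m n = F i k j l m n"
    "\<And>i j k l m n. F i j k l m n = F l m n i j k"
  shows "(\<Sum>\<pi> | \<pi> permutes {1..6}. F (\<pi> 1) (\<pi> 2) (\<pi> 3) (\<pi> 4) (\<pi> 5) (\<pi> 6)) = 72 * splittings_sum F"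
proof -
  have sym': "F i j k l m n = F i j k m l n" "F i j k l m n = F i j k l n m" for i j k l m n
    using sym by metis+
  have inner: "(\<Sum>q | q permutes {4,5,6}. F (\<tau> (q 1)) (\<tau> (q 2)) (\<tau> (q 3)) (\<tau> (q 4)) (\<tau> (q 5)) (\<tau> (q 6)))
      = 6 * F (\<tau> 1) (\<tau> 2) (\<tau> 3) (\<tau> 4) (\<tau> 5) (\<tau> 6)" for \<tau> :: "nat \<Rightarrow> nat"
    by (simp add: sum_over_permutations_insert transpose_def sym' del: One_nat_def)
  let ?G = "\<lambda>\<tau>. F (\<tau> 1) (\<tau> 2) (\<tau> 3) (\<tau> 4) (\<tau> 5) (\<tau> 6)"
  have "(\<Sum>\<pi> | \<pi> permutes {1..6}. ?G \<pi>) = 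
    (\<Sum>a\<in>{1,2,3,4,5,6}. \<Sum>b\<in>{2,3,4,5,6}. \<Sum>c\<in>{3,4,5,6}.
      \<Sum>q | q permutes {4,5,6}. ?G (transpose 1 a \<circ> (transpose 2 b \<circ> (transpose 3 c \<circ> q))))"
    unfolding one_to_six
    by (simp only: sum_permutes_insert_six)
  also have "\<dots> = 6 * (\<Sum>a\<in>{1,2,3,4,5,6}. \<Sum>b\<in>{2,3,4,5,6}. \<Sum>c\<in>{3,4,5,6}.
      ?G (transpose 1 a \<circ> transpose 2 b \<circ> transpose 3 c))"
    using inner[of "transpose 1 a \<circ> transpose 2 b \<circ> transpose 3 c" for a b c]
    by (simp only: sum_distrib_left o_apply)
  also have "\<dots> = 72 * splittings_sum F"
    unfolding splittings_sum_def
    by (simp add: transpose_def del: One_nat_def) (simp only: sym sym', simp)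
  finally show ?thesis .
qed

text \<open>A single term is a product over the edges of a triangular prism and lacks the symmetry
  of the splittings. Averaging over the permutations of \<open>4, 5, 6\<close> replaces its three
  cross edges by a permanent, giving the symmetric \<open>prisms w\<close>; the factor is 72 / 6 =
  12.\<close>

lemma sum_permutes_prisms:
  fixes w :: "nat \<Rightarrow> nat \<Rightarrow> complex"
  assumes sym: "\<And>i j. w i j = w j i"
  shows "(\<Sum>\<pi> | \<pi> permutes {1..6}. w (\<pi> 1) (\<pi> 2) * w (\<pi> 2) (\<pi> 3) * w (\<pi> 3) (\<pi> 1)
            * w (\<pi> 4) (\<pi> 5) * w (\<pi> 5) (\<pi> 6) * w (\<pi> 6) (\<pi> 4)
            * w (\<pi> 1) (\<pi> 4) * w (\<pi> 2) (\<pi> 5) * w (\<pi> 3) (\<pi> 6))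
    = 12 * splittings_sum (prisms w)" (is "(\<Sum>\<pi> | _. ?G \<pi>) = _")
proof -
  have inner: "(\<Sum>q | q permutes {4,5,6}. ?G (\<pi> \<circ> q)) = prisms w (\<pi> 1) (\<pi> 2) (\<pi> 3) (\<pi> 4) (\<pi> 5) (\<pi> 6)" for \<pi>
    by (simp add: sum_over_permutations_insert transpose_def prisms_def triangles_def del: One_nat_def)
       (simp only: sym[of "\<pi> 3" "\<pi> 1"] sym[of "\<pi> 5" "\<pi> 4"] sym[of "\<pi> 6" "\<pi> 4"] sym[of "\<pi> 6" "\<pi> 5"], algebra)
  have "(\<Sum>\<pi> | \<pi> permutes {1..6}. ?G (\<pi> \<circ> q)) = (\<Sum>\<pi> | \<pi> permutes {1..6}. ?G \<pi>)" if "q permutes {4,5,6}" for q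
  proof -
    have "q permutes {1..6}"
      using that by (rule permutes_subset) auto
    then show ?thesis
      by (rule sum_permutations_compose_right[symmetric])
  qed
  then have "(\<Sum>q | q permutes {4,5,6}. \<Sum>\<pi> | \<pi> permutes {1..6}. ?G (\<pi> \<circ> q))
      = of_nat (card {q. q permutes {4,5,6::nat}}) * (\<Sum>\<pi> | \<pi> permutes {1..6}. ?G \<pi>)"
    by simp
  also have "card {q. q permutes {4,5,6::nat}} = 6"
    by (subst card_permutations[of _ 3]) (auto simp: eval_nat_numeral)
  also have "(\<Sum>q | q permutes {4,5,6}. \<Sum>\<pi> | \<pi> permutes {1..6}. ?G (\<pi> \<circ> q))
      = (\<Sum>\<pi> | \<pi> permutes {1..6}. prisms w (\<pi> 1) (\<pi> 2) (\<pi> 3) (\<pi> 4) (\<pi> 5) (\<pi> 6))"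
    by (subst sum.swap) (simp only: inner)
  also have "\<dots> = 72 * splittings_sum (prisms w)"
  proof (rule sum_permutes_splittings, goal_cases)
    case (1 i j k l m n) show ?case
      unfolding prisms_def triangles_def sym[of j i] by algebra
  next
    case (2 i j k l m n) show ?case
      unfolding prisms_def triangles_def sym[of k j] by algebra
  next
    case (3 i j k l m n) show ?case
      unfolding prisms_def triangles_def
        sym[of l i] sym[of l j] sym[of l k] sym[of m i] sym[of m j] sym[of m k] sym[of n i] sym[of n j] sym[of n k]
      by algebra
  qed
  finally show ?thesis by simp
qed

lemma sum_permutes_triangles:
  fixes w :: "nat \<Rightarrow> nat \<Rightarrow> complex"
  assumes sym: "\<And>i j. w i j = w j i"
  shows "(\<Sum>\<pi> | \<pi> permutes {1..6}. w (\<pi> 1) (\<pi> 2) * w (\<pi> 2) (\<pi> 3) * w (\<pi> 3) (\<pi> 1)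
            * w (\<pi> 4) (\<pi> 5) * w (\<pi> 5) (\<pi> 6) * w (\<pi> 6) (\<pi> 4))
    = 72 * splittings_sum (triangles w)"
proof -
  have *: "w i j * w j k * w k i * w l m * w m n * w n l = triangles w i j k l m n" for i j k l m n
    unfolding triangles_def sym[of k i] sym[of n l] by algebra
  show ?thesis
    unfolding *
  proof (rule sum_permutes_splittings, goal_cases)
    case (1 i j k l m n) show ?case
      unfolding triangles_def sym[of j i] by algebra
  next
    case (2 i j k l m n) show ?case
      unfolding triangles_def sym[of k j] by algebra
  next
    case (3 i j k l m n) show ?case
      unfolding triangles_def by algebra
  qed
qed

lemma pairs_upto_six: "{(i, j). 1 \<le> i \<and> i < j \<and> j \<le> (6::nat)} =
  {(1,2),(1,3),(1,4),(1,5),(1,6),(2,3),(2,4),(2,5),(2,6),(3,4),(3,5),(3,6),(4,5),(4,6),(5,6)}"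
  (is "?E = ?E'")
proof (intro set_eqI iffI)
  fix x assume "x \<in> ?E"
  then obtain i j where x: "x = (i, j)" "1 \<le> i" "i < j" "j \<le> 6" by blast
  then have "i \<in> {1..6}" "j \<in> {1..6}" by simp_all
  then have "i \<in> {1,2,3,4,5,6}" "j \<in> {1,2,3,4,5,6}" unfolding one_to_six .
  with x(3) have "(i, j) \<in> ?E'"
    by (elim insertE emptyE; simp)
  with x(1) show "x \<in> ?E'" by simp
qed auto

definition vandermonde_square :: "(nat \<Rightarrow> nat \<Rightarrow> 'a :: comm_ring_1) \<Rightarrow> 'a" where
  "vandermonde_square w = w 1 2 * w 1 3 * w 1 4 * w 1 5 * w 1 6 * w 2 3 * w 2 4 * w 2 5 * w 2 6
     * w 3 4 * w 3 5 * w 3 6 * w 4 5 * w 4 6 * w 5 6"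

lemma igusa_clebsch_formula_eq:
  assumes sym: "\<And>i j. (d i j)^2 = (d j i)^2"
  defines "w \<equiv> \<lambda>i j. (d i j)^2"
  shows "igusa_clebsch_formula d a =
    (a^2 * matchings_sum w, a^4 * splittings_sum (triangles w), a^6 * splittings_sum (prisms w),
     a^10 * vandermonde_square w)"
proof -
  have w: "w i j = w j i" for i j
    unfolding w_def by (rule sym)
  have d: "(d i j)^2 = w i j" for i j
    by (simp add: w_def)
  show ?thesis
    unfolding igusa_clebsch_formula_def Let_def d pairs_upto_six
      sum_permutes_matchings[of w, OF w] sum_permutes_triangles[of w, OF w] sum_permutes_prisms[of w, OF w]
    by (simp add: vandermonde_square_def mult.assoc del: One_nat_def)
qed

section \<open>Clebsch's invariants of a binary sextic\<close>

text \<open>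
  A binary form of degree \<open>m\<close> is given by its binomial coefficients \<open>a\<close>, as
  \<open>\<Sum>k\<le>m. (m choose k) a\<^sub>k x\<^sup>k z\<^sup>m\<^sup>-\<^sup>k\<close>. Up to a constant, \<open>contraction m n a b\<close> is the
  \<open>n\<close>-th transvectant of forms of degrees \<open>m\<close> and \<open>n\<close>, and \<open>fourth_transvectant a\<close> is the fourth
  transvectant of a sextic with itself.
\<close>

definition contraction :: "nat \<Rightarrow> nat \<Rightarrow> (nat \<Rightarrow> complex) \<Rightarrow> (nat \<Rightarrow> complex) \<Rightarrow> nat \<Rightarrow> complex" where
  "contraction m n a b k =
     (if k \<le> m - n then (\<Sum>j\<le>n. (- 1)^j * of_nat (n choose j) * a (k + j) * b (n - j)) else 0)"

definition fourth_transvectant :: "(nat \<Rightarrow> complex) \<Rightarrow> nat \<Rightarrow> complex" where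
  "fourth_transvectant a k =
     (if k = 0 then 6 * (a 0 * a 4 - 4 * (a 1 * a 3) + 3 * (a 2)^2)
      else if k = 1 then 3 * (a 0 * a 5 - 3 * (a 1 * a 4) + 2 * (a 2 * a 3))
      else if k = 2 then a 0 * a 6 - 9 * (a 2 * a 4) + 8 * (a 3)^2
      else if k = 3 then 3 * (a 1 * a 6 - 3 * (a 2 * a 5) + 2 * (a 3 * a 4))
      else if k = 4 then 6 * (a 2 * a 6 - 4 * (a 3 * a 5) + 3 * (a 4)^2)
      else 0)"

text \<open>The determinant of the Hankel matrix \<open>b (i + j)\<close>,
  \<open>i, j \<le> 2\<close>: the cubic invariant of a binary quartic.\<close>

definition catalecticant :: "(nat \<Rightarrow> complex) \<Rightarrow> complex" where
  "catalecticant b = b 0 * b 2 * b 4 + 2 * (b 1 * b 2 * b 3) - (b 2)^3 - b 0 * (b 3)^2 - (b 1)^2 * b 4"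

text \<open>The substitution \<open>x \<mapsto> x + t z\<close> on binomial coefficients. Entries
  beyond the degree are 0, so that covariance can be stated as an equality of functions.\<close>

definition translate :: "nat \<Rightarrow> complex \<Rightarrow> (nat \<Rightarrow> complex) \<Rightarrow> nat \<Rightarrow> complex" where
  "translate n t a k = (if k \<le> n then (\<Sum>j\<le>n - k. of_nat ((n - k) choose j) * t^j * a (k + j)) else 0)"

definition flip :: "nat \<Rightarrow> (nat \<Rightarrow> complex) \<Rightarrow> nat \<Rightarrow> complex" where
  "flip n a k = (if k \<le> n then a (n - k) else 0)"

section \<open>Covariance under translation and inversion\<close>

lemma quartic_eqI:
  assumes "f 0 = g 0" "f 1 = g 1" "f 2 = g 2" "f 3 = g 3" "f 4 = g 4" "\<And>k :: nat. 4 < k \<Longrightarrow> f k = g k"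
  shows "f = g"
proof
  fix k :: nat
  consider "k = 0" | "k = 1" | "k = 2" | "k = 3" | "k = 4" | "4 < k" by linarith
  then show "f k = g k" by cases (simp_all only: assms)
qed

lemma quadratic_eqI:
  assumes "f 0 = g 0" "f 1 = g 1" "f 2 = g 2" "\<And>k :: nat. 2 < k \<Longrightarrow> f k = g k"
  shows "f = g"
proof
  fix k :: nat
  consider "k = 0" | "k = 1" | "k = 2" | "2 < k" by linarith
  then show "f k = g k" by cases (simp_all only: assms)
qed

lemma fourth_transvectant_translate:
  "fourth_transvectant (translate 6 t a) = translate 4 t (fourth_transvectant a)"
  by (rule quartic_eqI; simp add: fourth_transvectant_def translate_def eval_nat_numeral; algebra?)

lemma fourth_transvectant_flip: "fourth_transvectant (flip 6 a) = flip 4 (fourth_transvectant a)"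
  by (rule quartic_eqI) (simp_all add: fourth_transvectant_def flip_def)

text \<open>Transvectants are covariant under substitutions of determinant 1; here this is verified
  coefficient by coefficient.\<close>

lemma contraction_translate:
  "contraction 6 4 (translate 6 t a) (translate 4 t b) = translate 2 t (contraction 6 4 a b)"
  "contraction 4 2 (translate 4 t b) (translate 2 t c) = translate 2 t (contraction 4 2 b c)"
  "contraction 6 6 (translate 6 t a) (translate 6 t a) 0 = contraction 6 6 a a 0"
  "contraction 4 4 (translate 4 t b) (translate 4 t b) 0 = contraction 4 4 b b 0"
  "contraction 2 2 (translate 2 t c) (translate 2 t d) 0 = contraction 2 2 c d 0"
  by (rule quadratic_eqI; simp add: contraction_def translate_def eval_nat_numeral; algebra?)+
     (simp add: contraction_def translate_def eval_nat_numeral; algebra)+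

text \<open>The exchange of variables has determinant -1, but all contractions involved have even
  order \<open>n\<close>, so reversing the sum produces no sign.\<close>

lemma contraction_flip:
  "contraction 6 4 (flip 6 a) (flip 4 b) = flip 2 (contraction 6 4 a b)"
  "contraction 4 2 (flip 4 b) (flip 2 c) = flip 2 (contraction 4 2 b c)"
  "contraction 6 6 (flip 6 a) (flip 6 a) 0 = contraction 6 6 a a 0"
  "contraction 4 4 (flip 4 b) (flip 4 b) 0 = contraction 4 4 b b 0"
  "contraction 2 2 (flip 2 c) (flip 2 d) 0 = contraction 2 2 c d 0"
  by (rule quadratic_eqI; simp add: contraction_def flip_def eval_nat_numeral)+
     (simp_all add: contraction_def flip_def eval_nat_numeral)

lemma catalecticant_translate: "catalecticant (translate 4 t b) = catalecticant b"
  by (simp add: catalecticant_def translate_def eval_nat_numeral) algebra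

lemma catalecticant_flip: "catalecticant (flip 4 b) = catalecticant b"
  by (simp add: catalecticant_def flip_def eval_nat_numeral)

type_synonym quadruple = "complex \<times> complex \<times> complex \<times> complex"

text \<open>Clebsch's A, B, C, D up to constant factors; \<open>y1\<close>, \<open>y2\<close>,
  \<open>y3\<close> are his quadratic covariants, of degrees 3, 5, 7 in the coefficients.\<close>

definition clebsch_invariants :: "(nat \<Rightarrow> complex) \<Rightarrow> quadruple" where
  "clebsch_invariants a =
    (let i = fourth_transvectant a; y1 = contraction 6 4 a i; y2 = contraction 4 2 i y1; y3 = contraction 4 2 i y2
     in (contraction 6 6 a a 0, contraction 4 4 i i 0, catalecticant i, contraction 2 2 y3 y1 0))"

lemma clebsch_invariants_translate: "clebsch_invariants (translate 6 t a) = clebsch_invariants a"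
  by (simp only: clebsch_invariants_def Let_def fourth_transvectant_translate contraction_translate catalecticant_translate)

lemma clebsch_invariants_flip: "clebsch_invariants (flip 6 a) = clebsch_invariants a"
  by (simp only: clebsch_invariants_def Let_def fourth_transvectant_flip contraction_flip catalecticant_flip)

text \<open>
  Clebsch's relations \<open>I\<^sub>2 = -120A\<close>, \<open>I\<^sub>4 = -720A\<^sup>2 + 6750B\<close>, \<open>I\<^sub>6 = 8640A\<^sup>3 - 108000AB + 202500C\<close>,
  \<open>I\<^sub>1\<^sub>0 = -62208A\<^sup>5 + 972000A\<^sup>3B + 1620000A\<^sup>2C - 3037500AB\<^sup>2 - 6075000BC - 4556250D\<close>, adjusted to the
  scaling of \<open>clebsch_invariants\<close> and to the factor 60 by which \<open>scaled_coeff\<close> makes the binomial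
  coefficients of an integral sextic integral.
\<close>

definition igusa_clebsch_of_clebsch :: "quadruple \<Rightarrow> quadruple" where
  "igusa_clebsch_of_clebsch = (\<lambda>(A, B, C, D).
     (- A / 30,
      - (A^2) / 18000 + B / 17280,
      A^3 / 5400000 - A * B / 3888000 + C / 1036800,
      - (A^5) / 9720000000000 + A^3 * B / 5598720000000 + A^2 * C / 1679616000000
        - A * B^2 / 16124313600000 - B * C / 4031078400000 - D / 10749542400000))"

definition scaled_coeff :: "complex poly \<Rightarrow> nat \<Rightarrow> complex" where
  "scaled_coeff f j = 60 * coeff f j / of_nat (6 choose j)"

text \<open>The hypotheses describe \<open>scaled_coeff\<close> of
  \<open>x (x^4 - e1 x^3 + e2 x^2 - e3 x + e4)\<close>, a sextic with roots at 0 and infinity, in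
  terms of the elementary symmetric functions of its other four roots.\<close>

lemma igusa_clebsch_of_clebsch_quartic:
  fixes e1 e2 e3 e4 :: complex
  assumes "b 0 = 0" "b 1 = 10 * e4" "b 2 = - (4 * e3)" "b 3 = 3 * e2" "b 4 = - (4 * e1)" "b 5 = 10" "b 6 = 0"
  shows "igusa_clebsch_of_clebsch (clebsch_invariants b) =
    (40 * e4 + 6 * e2^2 - 16 * e1 * e3,
     -80 * e4^2 + 36 * e2^2 * e4 - 12 * e2 * e3^2 + 4 * e1^2 * e3^2 - 12 * e1^2 * e2 * e4 + 4 * e1
       * e3 * e4,
     -320 * e4^3 - 36 * e3^4 + 72 * e2^4 * e4 - 24 * e2^3 * e3^2 + 176 * e2^2 * e4^2 + 26 * e2 *
       e3^2 * e4 - 36 * e1^4 * e4^2 - 24 * e1^3 * e3^3 + 76 * e1^3 * e2 * e3 * e4 + 28 * e1^2 * e3^2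
       * e4 - 24 * e1^2 * e2^3 * e4 + 8 * e1^2 * e2^2 * e3^2 + 26 * e1^2 * e2 * e4^2 + 64 * e1 * e3
       * e4^2 - 238 * e1 * e2^2 * e3 * e4 + 76 * e1 * e2 * e3^3,
     256 * e4^5 - 27 * e3^4 * e4^2 + 16 * e2^4 * e4^3 - 4 * e2^3 * e3^2 * e4^2 - 128 * e2^2 * e4^4
       + 144 * e2 * e3^2 * e4^3 - 27 * e1^4 * e4^4 - 4 * e1^3 * e3^3 * e4^2 + 18 * e1^3 * e2 * e3 *
       e4^3 - 6 * e1^2 * e3^2 * e4^3 - 4 * e1^2 * e2^3 * e4^3 + e1^2 * e2^2 * e3^2 * e4^2 + 144 *
       e1^2 * e2 * e4^4 - 192 * e1 * e3 * e4^4 - 80 * e1 * e2^2 * e3 * e4^3 + 18 * e1 * e2 * e3^3 *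
       e4^2)"
proof -
  have b: "b (Suc 0) = 10 * e4" "b (Suc (Suc 0)) = - (4 * e3)" "b (Suc (Suc (Suc 0))) = 3 * e2"
      "b (Suc (Suc (Suc (Suc 0)))) = - (4 * e1)" "b (Suc (Suc (Suc (Suc (Suc 0))))) = 10"
      "b (Suc (Suc (Suc (Suc (Suc (Suc 0)))))) = 0"
    using assms by (simp_all add: eval_nat_numeral)
  show ?thesis
    unfolding clebsch_invariants_def igusa_clebsch_of_clebsch_def Let_def
    by (simp add: contraction_def fourth_transvectant_def catalecticant_def eval_nat_numeral b assms(1))
       (intro conjI; algebra)
qed

section \<open>Linear substitutions\<close>

text \<open>\<open>f\<close>, read as a binary form of degree \<open>n\<close>, evaluated at \<open>(P, Q)\<close>.\<close>

definition subst_form :: "nat \<Rightarrow> complex poly \<Rightarrow> complex poly \<Rightarrow> complex poly \<Rightarrow> complex poly" where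
  "subst_form n f P Q = (\<Sum>j\<le>n. smult (coeff f j) (P^j * Q^(n - j)))"

lemma poly_subst_form:
  assumes "degree f \<le> n" "poly Q x \<noteq> 0"
  shows "poly (subst_form n f P Q) x = poly Q x ^ n * poly f (poly P x / poly Q x)"
proof -
  have "poly f y = (\<Sum>j\<le>n. coeff f j * y^j)" for y
    unfolding poly_altdef using assms(1)
    by (intro sum.mono_neutral_left) (auto simp: coeff_eq_0)
  then show ?thesis
    using assms(2)
    by (auto simp: subst_form_def poly_sum sum_distrib_left power_divide power_diff field_simps intro!: sum.cong)
qed

text \<open>The product \<open>r * (p - q)\<close> vanishes everywhere and \<open>r\<close> is
  nonzero. This permits division by \<open>Q\<close> when identities between substituted forms are
  checked pointwise.\<close>

lemma poly_eqI_off_roots: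
  fixes p q r :: "complex poly"
  assumes "r \<noteq> 0" "\<And>x. poly r x \<noteq> 0 \<Longrightarrow> poly p x = poly q x"
  shows "p = q"
proof -
  have "poly (r * (p - q)) = poly 0"
    using assms(2) by fastforce
  then show ?thesis
    using assms(1) unfolding poly_eq_poly_eq_iff by simp
qed

lemma subst_form_mult:
  assumes "degree f \<le> m" "degree g \<le> n" "Q \<noteq> 0"
  shows "subst_form (m + n) (f * g) P Q = subst_form m f P Q * subst_form n g P Q"
proof (rule poly_eqI_off_roots[OF assms(3)])
  fix x assume "poly Q x \<noteq> 0"
  moreover have "degree (f * g) \<le> m + n"
    using degree_mult_le[of f g] assms by linarith
  ultimately show "poly (subst_form (m + n) (f * g) P Q) x = poly (subst_form m f P Q * subst_form n g P Q) x"
    using assms by (simp add: poly_subst_form power_add)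
qed

lemma degree_le_1E:
  assumes "degree (p :: complex poly) \<le> 1"
  obtains b c where "p = [:b, c:]"
proof
  show "p = [:coeff p 0, coeff p 1:]"
    using assms by (intro poly_eqI) (auto simp: coeff_pCons coeff_eq_0 split: nat.split)
qed

lemma subst_form_linear: "subst_form 1 [:b, c:] P Q = smult b Q + smult c P"
  by (simp add: subst_form_def)

text \<open>Multiplicativity of the 2 by 2 determinant.\<close>

lemma bracket_subst_form:
  assumes "degree l \<le> 1" "degree l' \<le> 1"
  shows "bracket (subst_form 1 l P Q) (subst_form 1 l' P Q) = bracket P Q * bracket l l'"
  using assms by (elim degree_le_1E) (simp only: subst_form_linear, simp add: bracket_def algebra_simps)

lemma splits_sextic_subst_form:
  assumes f: "splits_sextic f a l" and "degree P \<le> 1" "degree Q \<le> 1" "Q \<noteq> 0"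
  shows "splits_sextic (subst_form 6 f P Q) a (\<lambda>i. subst_form 1 (l i) P Q)"
proof -
  have l: "degree (l i) \<le> 1" if "i \<in> {1..6}" for i
    using f that by (simp add: splits_sextic_def)
  have "degree (subst_form 1 (l i) P Q) \<le> 1" if "i \<in> {1..6}" for i
    using l[OF that] assms(2,3)
    by (elim degree_le_1E) (simp add: subst_form_linear degree_add_le del: One_nat_def)
  moreover have "subst_form 6 f P Q = smult a (\<Prod>i\<in>{1..6}. subst_form 1 (l i) P Q)"
  proof (rule poly_eqI_off_roots[OF assms(4)])
    fix x assume x: "poly Q x \<noteq> 0"
    have "degree f \<le> (\<Sum>i\<in>{1..6}. degree (l i))"
      using f degree_prod_sum_le[of "{1..6}" l] degree_smult_le[of a "\<Prod>i\<in>{1..6}. l i"]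
      by (simp add: splits_sextic_def)
    also have "\<dots> \<le> 6"
      using sum_mono[of "{1..6}" "\<lambda>i. degree (l i)" "\<lambda>_. 1"] l by simp
    finally have "poly (subst_form 6 f P Q) x = poly Q x ^ 6 * poly f (poly P x / poly Q x)"
      using x by (simp add: poly_subst_form)
    also have "\<dots> = a * (\<Prod>i\<in>{1..6}. poly Q x * poly (l i) (poly P x / poly Q x))"
      using f by (simp add: splits_sextic_def poly_prod prod.distrib)
    also have "\<dots> = a * (\<Prod>i\<in>{1..6}. poly (subst_form 1 (l i) P Q) x)"
      using l x by (simp add: poly_subst_form del: One_nat_def)
    finally show "poly (subst_form 6 f P Q) x = poly (smult a (\<Prod>i\<in>{1..6}. subst_form 1 (l i) P Q)) x"
      by (simp add: poly_prod)
  qed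
  ultimately show ?thesis
    by (simp add: splits_sextic_def)
qed

section \<open>The root formulas under linear substitutions\<close>

definition weighted_scale :: "complex \<Rightarrow> quadruple \<Rightarrow> quadruple" where
  "weighted_scale r = (\<lambda>(a, b, c, d). (r * a, r^2 * b, r^3 * c, r^5 * d))"

lemma igusa_clebsch_formula_smult:
  "igusa_clebsch_formula d (r^3 * a) = weighted_scale (r^6) (igusa_clebsch_formula d a)"
  by (simp add: igusa_clebsch_formula_def Let_def weighted_scale_def power_mult_distrib mult_ac flip: power_mult)

lemma igusa_clebsch_formula_scale:
  assumes "\<And>i j. (d i j)^2 = (d j i)^2"
  shows "igusa_clebsch_formula (\<lambda>i j. r * d i j) a = weighted_scale (r^6) (igusa_clebsch_formula d a)"
proof -
  have "igusa_clebsch_formula (\<lambda>i j. r * d i j) a = igusa_clebsch_formula d (r^3 * a)"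
  \<comment> \<open>The factor \<open>r\<close> is divided evenly between the two indices of
    \<open>d i j\<close>; the six square roots multiply to \<open>r^3\<close>.\<close>
  proof (rule igusa_clebsch_formula_rescale[of id _ "\<lambda>_. csqrt r"])
    have "csqrt r ^ 6 = (csqrt r ^ 2)^3"
      using power_mult[of "csqrt r" 2 3] by simp
    then show "r^3 * a = a * (\<Prod>i\<in>{1..6::nat}. csqrt r)"
      by simp
    show "r * d i j = csqrt r * csqrt r * d (id i) (id j)" for i j
      by (simp flip: power2_eq_square)
  qed (use assms in \<open>simp_all add: permutes_id\<close>)
  then show ?thesis
    by (simp add: igusa_clebsch_formula_smult)
qed

lemma bracket_square_commute: "(bracket l l')^2 = (bracket l' l)^2"
  by (simp add: bracket_def power2_commute mult.commute)

lemma igusa_clebsch_subst_form: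
  assumes "degree f \<le> 6" "degree P \<le> 1" "degree Q \<le> 1" "Q \<noteq> 0"
  shows "igusa_clebsch (subst_form 6 f P Q) = weighted_scale (bracket P Q ^ 6) (igusa_clebsch f)"
proof -
  obtain a l where l: "splits_sextic f a l"
    using splits_sextic_exists[OF assms(1)] .
  have "igusa_clebsch (subst_form 6 f P Q)
      = igusa_clebsch_formula (\<lambda>i j. bracket (subst_form 1 (l i) P Q) (subst_form 1 (l j) P Q)) a"
    by (rule igusa_clebsch_eq[OF splits_sextic_subst_form[OF l assms(2-4)]])
  also have "\<dots> = igusa_clebsch_formula (\<lambda>i j. bracket P Q * bracket (l i) (l j)) a"
  \<comment> \<open>With trivial scaling the rule acts as a congruence: the degrees of the
    \<open>l i\<close> are bounded only for indices in \<open>{1..6}\<close>.\<close>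
  proof (rule igusa_clebsch_formula_rescale[of id _ "\<lambda>_. 1"])
    fix i j :: nat assume "i \<in> {1..6}" "j \<in> {1..6}"
    then have "degree (l i) \<le> 1" "degree (l j) \<le> 1"
      using l by (simp_all add: splits_sextic_def)
    then show "bracket (subst_form 1 (l i) P Q) (subst_form 1 (l j) P Q)
        = 1 * 1 * (bracket P Q * bracket (l (id i)) (l (id j)))"
      by (simp add: bracket_subst_form del: One_nat_def)
  qed (simp_all add: permutes_id power_mult_distrib bracket_square_commute)
  also have "\<dots> = weighted_scale (bracket P Q ^ 6) (igusa_clebsch f)"
    by (simp add: igusa_clebsch_formula_scale[OF bracket_square_commute] igusa_clebsch_eq[OF l])
  finally show ?thesis .
qed

section \<open>Translation and inversion of sextics, on coefficients and on invariants\<close>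

lemma scaled_coeff_translate:
  "scaled_coeff (subst_form 6 f [:t, 1:] 1) = translate 6 t (scaled_coeff f)"
proof
  fix k :: nat
  have pow: "coeff ([:t, 1:]^j) k = of_nat (j choose k) * t^(j - k)" for j
  proof (cases "k \<le> j")
    case False
    then show ?thesis
      using degree_linear_power[of t j] by (simp add: coeff_eq_0 binomial_eq_0)
  qed (simp add: coeff_linear_poly_power)
  have c: "coeff (subst_form 6 f [:t, 1:] 1) k
      = (\<Sum>j\<le>6. coeff f j * (of_nat (j choose k) * t^(j - k)))"
    by (simp add: subst_form_def coeff_sum pow)
  \<comment> \<open>For \<open>6 < k\<close> the divisor \<open>6 choose k\<close> is 0, and
    division by it gives 0, in agreement with the cut-off in \<open>translate\<close>.\<close>
  consider "k = 0" | "k = 1" | "k = 2" | "k = 3" | "k = 4" | "k = 5" | "k = 6" | "6 < k" by linarith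
  then show "scaled_coeff (subst_form 6 f [:t, 1:] 1) k = translate 6 t (scaled_coeff f) k"
    unfolding scaled_coeff_def c translate_def
    by cases (simp_all add: eval_nat_numeral algebra_simps)
qed

lemma scaled_coeff_flip: "scaled_coeff (subst_form 6 f 1 [:0, 1:]) = flip 6 (scaled_coeff f)"
proof
  fix k :: nat
  have X: "[:0, 1:]^j = monom (1 :: complex) j" for j
    by (simp add: monom_altdef)
  have c: "coeff (subst_form 6 f 1 [:0, 1:]) k = (\<Sum>j\<le>6. if 6 - j = k then coeff f j else 0)"
    by (simp add: subst_form_def coeff_sum X if_distrib cong: if_cong)
  consider "k = 0" | "k = 1" | "k = 2" | "k = 3" | "k = 4" | "k = 5" | "k = 6" | "6 < k" by linarith
  then show "scaled_coeff (subst_form 6 f 1 [:0, 1:]) k = flip 6 (scaled_coeff f) k"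
    unfolding scaled_coeff_def c flip_def
    by cases (simp_all add: eval_nat_numeral)
qed

abbreviation igusa_clebsch_coeffs :: "complex poly \<Rightarrow> quadruple" where
  "igusa_clebsch_coeffs f \<equiv> igusa_clebsch_of_clebsch (clebsch_invariants (scaled_coeff f))"

lemma igusa_clebsch_coeffs_translate:
  "igusa_clebsch_coeffs (subst_form 6 f [:t, 1:] 1) = igusa_clebsch_coeffs f"
  by (simp only: scaled_coeff_translate clebsch_invariants_translate)

lemma igusa_clebsch_coeffs_flip:
  "igusa_clebsch_coeffs (subst_form 6 f 1 [:0, 1:]) = igusa_clebsch_coeffs f"
  by (simp only: scaled_coeff_flip clebsch_invariants_flip)

lemma weighted_scale_1 [simp]: "weighted_scale 1 I = I"
  by (simp add: weighted_scale_def split: prod.splits)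

lemma igusa_clebsch_translate:
  "degree f \<le> 6 \<Longrightarrow> igusa_clebsch (subst_form 6 f [:t, 1:] 1) = igusa_clebsch f"
  by (subst igusa_clebsch_subst_form) (simp_all add: bracket_def)

text \<open>The substitution has determinant -1, which enters only through its sixth power.\<close>

lemma igusa_clebsch_flip:
  "degree f \<le> 6 \<Longrightarrow> igusa_clebsch (subst_form 6 f 1 [:0, 1:]) = igusa_clebsch f"
  by (subst igusa_clebsch_subst_form) (simp_all add: bracket_def)

section \<open>Invariants in terms of the coefficients\<close>

lemma contraction_scale:
  "contraction m n (\<lambda>k. c * a k) (\<lambda>k. d * b k) = (\<lambda>k. c * d * contraction m n a b k)"
  by (auto simp: contraction_def sum_distrib_left mult_ac intro!: sum.cong)

lemma fourth_transvectant_scale: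
  "fourth_transvectant (\<lambda>k. c * a k) = (\<lambda>k. c^2 * fourth_transvectant a k)"
  by (auto simp: fourth_transvectant_def algebra_simps power2_eq_square)

lemma catalecticant_scale: "catalecticant (\<lambda>k. c * b k) = c^3 * catalecticant b"
  by (simp add: catalecticant_def) algebra

text \<open>A, B, C, D have degrees 2, 4, 6, 10 in the coefficients, and the conversion is
  homogeneous.\<close>

lemma igusa_clebsch_of_clebsch_scale:
  "igusa_clebsch_of_clebsch (clebsch_invariants (\<lambda>k. c * a k))
    = weighted_scale (c^2) (igusa_clebsch_of_clebsch (clebsch_invariants a))"
  unfolding clebsch_invariants_def Let_def fourth_transvectant_scale contraction_scale catalecticant_scale
    igusa_clebsch_of_clebsch_def weighted_scale_def prod.case
  by (intro arg_cong2[where f = Pair]; algebra)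

text \<open>The normalized case, with roots at infinity, 0, \<open>p\<close>, \<open>q\<close>,
  \<open>r\<close>, \<open>s\<close>: both sides are written in the elementary symmetric functions
  of the four free roots.\<close>

lemma igusa_clebsch_eq_coeffs_quartic:
  assumes g: "g = smult c ([:0, 1:] * ([:- p, 1:] * [:- q, 1:] * [:- r, 1:] * [:- s, 1:]))"
  shows "igusa_clebsch g = igusa_clebsch_coeffs g"
proof -
  define e1 e2 e3 e4 where "e1 = p + q + r + s" and "e2 = p * q + p * r + p * s + q * r + q * s + r * s"
    and "e3 = p * q * r + p * q * s + p * r * s + q * r * s" and "e4 = p * q * r * s"
  note e_defs = e1_def e2_def e3_def e4_def
  define l :: "nat \<Rightarrow> complex poly" where
    "l i = (if i = 1 then 1 else [:- (if i = 2 then 0 else if i = 3 then p else if i = 4 then q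
                                   else if i = 5 then r else s), 1:])" for i
  define w where "w i j = (bracket (l i) (l j))^2" for i j
  have l: "l 1 = 1" "l 2 = [:0, 1:]" "l 3 = [:- p, 1:]" "l 4 = [:- q, 1:]" "l 5 = [:- r, 1:]" "l 6 = [:- s, 1:]"
    by (simp_all add: l_def)
  have "splits_sextic g c l"
    unfolding splits_sextic_def prod_six l g by (simp add: l_def mult.assoc)
  then have "igusa_clebsch g = igusa_clebsch_formula (\<lambda>i j. bracket (l i) (l j)) c"
    by (rule igusa_clebsch_eq)
  also have "\<dots> = weighted_scale (c^2) (matchings_sum w, splittings_sum (triangles w),
      splittings_sum (prisms w), vandermonde_square w)"
    unfolding igusa_clebsch_formula_eq[of "\<lambda>i j. bracket (l i) (l j)", OF bracket_square_commute]
    by (simp add: weighted_scale_def w_def[abs_def] flip: power_mult)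
  \<comment> \<open>The form \<open>l 1 = 1\<close> has its root at infinity, so its bracket with
    each other form is -1.\<close>
  also have w: "w 1 2 = 1" "w 1 3 = 1" "w 1 4 = 1" "w 1 5 = 1" "w 1 6 = 1"
    "w 2 3 = p^2" "w 2 4 = q^2" "w 2 5 = r^2" "w 2 6 = s^2" "w 3 4 = (p - q)^2" "w 3 5 = (p - r)^2"
    "w 3 6 = (p - s)^2" "w 4 5 = (q - r)^2" "w 4 6 = (q - s)^2" "w 5 6 = (r - s)^2"
    "w 3 2 = p^2" "w 4 2 = q^2" "w 5 2 = r^2" "w 6 2 = s^2" "w 4 3 = (p - q)^2" "w 5 3 = (p - r)^2"
    "w 6 3 = (p - s)^2" "w 5 4 = (q - r)^2" "w 6 4 = (q - s)^2" "w 6 5 = (r - s)^2"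
    unfolding w_def l bracket_def by (simp_all add: power2_commute)
  \<comment> \<open>The calculation substitutes this equality inside
    \<open>weighted_scale (c^2)\<close>.\<close>
  have "(matchings_sum w, splittings_sum (triangles w), splittings_sum (prisms w), vandermonde_square w) =
    (40 * e4 + 6 * e2^2 - 16 * e1 * e3,
     -80 * e4^2 + 36 * e2^2 * e4 - 12 * e2 * e3^2 + 4 * e1^2 * e3^2 - 12 * e1^2 * e2 * e4 + 4 * e1
       * e3 * e4,
     -320 * e4^3 - 36 * e3^4 + 72 * e2^4 * e4 - 24 * e2^3 * e3^2 + 176 * e2^2 * e4^2 + 26 * e2 *
       e3^2 * e4 - 36 * e1^4 * e4^2 - 24 * e1^3 * e3^3 + 76 * e1^3 * e2 * e3 * e4 + 28 * e1^2 * e3^2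
       * e4 - 24 * e1^2 * e2^3 * e4 + 8 * e1^2 * e2^2 * e3^2 + 26 * e1^2 * e2 * e4^2 + 64 * e1 * e3
       * e4^2 - 238 * e1 * e2^2 * e3 * e4 + 76 * e1 * e2 * e3^3,
     256 * e4^5 - 27 * e3^4 * e4^2 + 16 * e2^4 * e4^3 - 4 * e2^3 * e3^2 * e4^2 - 128 * e2^2 * e4^4
       + 144 * e2 * e3^2 * e4^3 - 27 * e1^4 * e4^4 - 4 * e1^3 * e3^3 * e4^2 + 18 * e1^3 * e2 * e3 *
       e4^3 - 6 * e1^2 * e3^2 * e4^3 - 4 * e1^2 * e2^3 * e4^3 + e1^2 * e2^2 * e3^2 * e4^2 + 144 *
       e1^2 * e2 * e4^4 - 192 * e1 * e3 * e4^4 - 80 * e1 * e2^2 * e3 * e4^3 + 18 * e1 * e2 * e3^3 *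
       e4^2)"
    unfolding matchings_sum_def splittings_sum_def prisms_def triangles_def vandermonde_square_def w e_defs
    by (intro arg_cong2[where f = Pair]; algebra)
  also have "\<dots> = igusa_clebsch_coeffs [:0, e4, - e3, e2, - e1, 1:]"
    by (rule igusa_clebsch_of_clebsch_quartic[symmetric]) (simp_all add: scaled_coeff_def eval_nat_numeral)
  also have "weighted_scale (c^2) \<dots> = igusa_clebsch_coeffs g"
  proof -
    have "g = smult c [:0, e4, - e3, e2, - e1, 1:]"
      unfolding g e_defs by (simp add: algebra_simps)
    moreover have "scaled_coeff (smult c h) = (\<lambda>k. c * scaled_coeff h k)" for h
      by (simp add: scaled_coeff_def fun_eq_iff)
    ultimately show ?thesis
      by (simp only: igusa_clebsch_of_clebsch_scale)
  qed
  finally show ?thesis .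
qed

section \<open>Reduction of quintics and sextics to the normalized case\<close>

lemma degree_subst_form_le:
  assumes "degree P \<le> 1" "degree Q \<le> 1"
  shows "degree (subst_form n f P Q) \<le> n"
  unfolding subst_form_def
proof (rule degree_sum_le)
  fix j assume j: "j \<in> {..n}"
  have pow: "degree (R^m) \<le> m" if "degree R \<le> 1" for R :: "complex poly" and m
    using order_trans[OF degree_power_le mult_le_mono1[OF that]] by simp
  show "degree (smult (coeff f j) (P^j * Q^(n - j))) \<le> n"
    using degree_smult_le[of "coeff f j" "P^j * Q^(n - j)"] degree_mult_le[of "P^j" "Q^(n - j)"]
      pow[OF assms(1), of j] pow[OF assms(2), of "n - j"] j by simp
qed simp

lemma quintic_decompose:
  assumes "degree (g :: complex poly) = 5"
  obtains c and r :: "nat \<Rightarrow> complex" where "c \<noteq> 0" "g = smult c (\<Prod>i<5. [:- r i, 1:])"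
proof -
  obtain r where "smult (lead_coeff g) (\<Prod>i<degree g. [:- r i, 1:]) = g"
    by (rule complex_poly_decompose')
  moreover have "lead_coeff g \<noteq> 0"
    using assms by (metis degree_0 leading_coeff_0_iff zero_neq_numeral)
  ultimately show thesis
    using that[of "lead_coeff g" r] assms by simp
qed

lemma igusa_clebsch_eq_coeffs_quintic:
  assumes "degree g = 5"
  shows "igusa_clebsch g = igusa_clebsch_coeffs g"
proof -
  obtain c and r :: "nat \<Rightarrow> complex" where r: "g = smult c (\<Prod>i<5. [:- r i, 1:])"
    using assms by (rule quintic_decompose)
  \<comment> \<open>As a sextic, \<open>g\<close> has a root at infinity already; the translation
    brings the root \<open>r 0\<close> to 0.\<close>
  define h where "h = subst_form 6 g [:r 0, 1:] 1"
  have "h = smult (c) ([:0, 1:] * ([:- (r 1 - r 0), 1:] * [:- (r 2 - r 0), 1:]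
      * [:- (r 3 - r 0), 1:] * [:- (r 4 - r 0), 1:]))" (is "_ = ?h")
  proof (rule poly_eqI_off_roots[of 1])
    fix x
    have "poly h x = poly g (x + r 0)"
      unfolding h_def using assms by (subst poly_subst_form) (simp_all add: add.commute)
    also have "\<dots> = poly ?h x"
      by (subst r) (simp add: eval_nat_numeral algebra_simps)
    finally show "poly h x = poly ?h x" .
  qed simp
  then have "igusa_clebsch h = igusa_clebsch_coeffs h"
    by (rule igusa_clebsch_eq_coeffs_quartic)
  then show ?thesis
    using assms by (simp add: h_def igusa_clebsch_translate igusa_clebsch_coeffs_translate)
qed

text \<open>A simple root is moved to infinity, which makes the sextic a quintic.\<close>

lemma igusa_clebsch_eq_coeffs_sextic:
  assumes f: "f = [:- x0, 1:] * H" and H: "degree H = 5" "poly H x0 \<noteq> 0"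
  shows "igusa_clebsch f = igusa_clebsch_coeffs f"
proof -
  obtain c and r :: "nat \<Rightarrow> complex" where c: "c \<noteq> 0" and r: "H = smult c (\<Prod>i<5. [:- r i, 1:])"
    using H(1) by (rule quintic_decompose)
  have "H \<noteq> 0" using H by auto
  then have f6: "degree f \<le> 6"
    unfolding f using H by (subst degree_mult_eq) auto
  have rx: "r i \<noteq> x0" if "i < 5" for i
  proof
    assume "r i = x0"
    then have "poly (\<Prod>i<5. [:- r i, 1:]) x0 = 0"
      using that by (auto simp: poly_prod intro!: prod_zero)
    then show False
      using H(2) by (subst (asm) r) simp
  qed
  \<comment> \<open>The root \<open>x0\<close> is moved to 0 by \<open>g\<close> and on to infinity
    by \<open>h\<close>. The other roots become \<open>1 / (r i - x0)\<close>, finite by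
    \<open>rx\<close>, so \<open>h\<close> has degree exactly 5.\<close>
  define g where "g = subst_form 6 f [:x0, 1:] 1"
  define h where "h = subst_form 6 g 1 [:0, 1:]"
  have g6: "degree g \<le> 6"
    unfolding g_def by (rule degree_subst_form_le) simp_all
  have "h = smult (c) (\<Prod>i<5. [:1, x0 - r i:])" (is "_ = ?h")
  proof (rule poly_eqI_off_roots[of "[:0, 1:]"])
    fix x :: complex assume "poly [:0, 1:] x \<noteq> 0"
    then have x: "x \<noteq> 0" by simp
    have "poly h x = x^6 * poly g (1 / x)"
      unfolding h_def using g6 x by (simp add: poly_subst_form)
    also have "poly g (1 / x) = poly f (x0 + 1 / x)"
      unfolding g_def using f6 by (simp add: poly_subst_form)
    also have "x^6 * \<dots> = x^5 * poly H (x0 + 1 / x)"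
      unfolding f using x by (simp add: eval_nat_numeral ring_distribs)
    also have "\<dots> = c * (\<Prod>i<5. x * (x0 + 1 / x - r i))"
      by (subst r) (simp add: poly_prod prod.distrib)
    also have "\<dots> = poly ?h x"
      using x by (simp add: poly_prod algebra_simps)
    finally show "poly h x = poly ?h x" .
  qed simp
  moreover have "degree (\<Prod>i<5. [:1, x0 - r i:]) = (\<Sum>i<5. degree [:1, x0 - r i:])"
    using rx by (intro degree_prod_eq_sum_degree) simp
  moreover have "(\<Sum>i<5. degree [:1, x0 - r i:]) = (\<Sum>i<5::nat. 1)"
    using rx by (intro sum.cong) (auto dest: sym)
  ultimately have "degree h = 5"
    using c by simp
  then have "igusa_clebsch h = igusa_clebsch_coeffs h"
    by (rule igusa_clebsch_eq_coeffs_quintic)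
  then show ?thesis
    unfolding h_def g_def igusa_clebsch_coeffs_flip igusa_clebsch_coeffs_translate
      igusa_clebsch_flip[OF g6[unfolded g_def]] igusa_clebsch_translate[OF f6] .
qed

section \<open>The sextic of the theorem\<close>

text \<open>Here \<open>u\<close>, \<open>v\<close> stand for \<open>\<mu>\<close> and its
  conjugate, \<open>x\<close>, \<open>y\<close> for \<open>\<eta>\<close> and its conjugate. The
  relation \<open>h = 5 - N\<close> enters only by writing the middle coefficient
  \<open>-10 N (N - 5)\<close> as \<open>10 N h\<close>; thus the identity holds for four
  independent variables.\<close>

lemma igusa_clebsch_of_clebsch_sparse:
  fixes u v x y N S h :: complex
  assumes "b 0 = 60 * (v^2 * y^3)" "b 1 = - (20 * (u * v^2 * y^2))" "b 2 = 0" "b 3 = 30 * (u * v * x * y)"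
    "b 4 = 0" "b 5 = - (20 * (u^2 * v * x^2))" "b 6 = 60 * (u^2 * x^3)"
  defines "N \<equiv> u * v" and "S \<equiv> u + v" and "h \<equiv> x * y"
  shows "igusa_clebsch_of_clebsch (clebsch_invariants b) =
    (-240 * h^3 * N^2 + 160 * h^2 * N^3 + 600 * h^2 * N^2,
     1620 * h^6 * N^4 - 2160 * h^5 * N^5 + 32400 * h^5 * N^4 - 1280 * h^4 * N^6 + 14400 * h^4 * N^5,
     -119880 * h^9 * N^6 + 239760 * h^8 * N^7 - 1004400 * h^8 * N^6 - 35840 * h^7 * N^8 + 727200 *
       h^7 * N^7 + 1620000 * h^7 * N^6 - 20480 * h^6 * N^9 + 281600 * h^6 * N^8 + 2880000 * h^6 *
       N^7 - 180000 * S * h^7 * N^7,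
     -46656 * h^15 * N^10 + 155520 * h^14 * N^11 + 3499200 * h^14 * N^10 + 8640 * h^13 * N^12 +
       6220800 * h^13 * N^11 - 87480000 * h^13 * N^10 - 373760 * h^12 * N^13 + 24667200 * h^12 *
       N^12 - 252720000 * h^12 * N^11 + 729000000 * h^12 * N^10 + 81920 * h^11 * N^14 - 1331200 *
       h^11 * N^13 + 262144 * h^10 * N^15 - 3276800 * h^10 * N^14 + 10240000 * h^10 * N^13 + 200000
       * S^2 * h^12 * N^12 - 2160000 * S * h^13 * N^11 - 720000 * S * h^12 * N^12 + 10800000 * S *
       h^12 * N^11 - 2560000 * S * h^11 * N^13 + 28800000 * S * h^11 * N^12 - 86400000 * S * h^11 *
       N^11)"
proof -
  have b: "b (Suc 0) = - (20 * (u * v^2 * y^2))" "b (Suc (Suc 0)) = 0" "b (Suc (Suc (Suc 0))) = 30 * (u * v * x * y)"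
      "b (Suc (Suc (Suc (Suc 0)))) = 0" "b (Suc (Suc (Suc (Suc (Suc 0))))) = - (20 * (u^2 * v * x^2))"
      "b (Suc (Suc (Suc (Suc (Suc (Suc 0)))))) = 60 * (u^2 * x^3)"
    using assms(1-7) by (simp_all add: eval_nat_numeral)
  show ?thesis
    unfolding clebsch_invariants_def igusa_clebsch_of_clebsch_def Let_def N_def S_def h_def
    by (simp only: contraction_def fourth_transvectant_def catalecticant_def)
       (simp add: eval_nat_numeral b assms(1), intro conjI; algebra)
qed

text \<open>Once powers of \<open>h N\<close> are taken out, \<open>h = 5 - N\<close> collapses the
  cofactors; in the first entry \<open>-24 h + 16 N + 60\<close> becomes
  \<open>20 (2 N - 3)\<close>.\<close>

lemma sparse_invariants_factor:
  fixes N m h S :: complex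
  assumes "h = 5 - N" "S = 2 * m"
  shows "(-240 * h^3 * N^2 + 160 * h^2 * N^3 + 600 * h^2 * N^2,
     1620 * h^6 * N^4 - 2160 * h^5 * N^5 + 32400 * h^5 * N^4 - 1280 * h^4 * N^6 + 14400 * h^4 * N^5,
     -119880 * h^9 * N^6 + 239760 * h^8 * N^7 - 1004400 * h^8 * N^6 - 35840 * h^7 * N^8 + 727200 *
       h^7 * N^7 + 1620000 * h^7 * N^6 - 20480 * h^6 * N^9 + 281600 * h^6 * N^8 + 2880000 * h^6 *
       N^7 - 180000 * S * h^7 * N^7,
     -46656 * h^15 * N^10 + 155520 * h^14 * N^11 + 3499200 * h^14 * N^10 + 8640 * h^13 * N^12 +
       6220800 * h^13 * N^11 - 87480000 * h^13 * N^10 - 373760 * h^12 * N^13 + 24667200 * h^12 *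
       N^12 - 252720000 * h^12 * N^11 + 729000000 * h^12 * N^10 + 81920 * h^11 * N^14 - 1331200 *
       h^11 * N^13 + 262144 * h^10 * N^15 - 3276800 * h^10 * N^14 + 10240000 * h^10 * N^13 + 200000
       * S^2 * h^12 * N^12 - 2160000 * S * h^13 * N^11 - 720000 * S * h^12 * N^12 + 10800000 * S *
       h^12 * N^11 - 2560000 * S * h^11 * N^13 + 28800000 * S * h^11 * N^12 - 86400000 * S * h^11 *
       N^11) =
    weighted_scale (10 * (h^2 * N^2))
     (20 * (2 * N - 3), 25 * (N - 9)^2,
      5 * (75 * N^3 + 72 * m * N^2 - 1165 * N^2 - 360 * m * N + 5985 * N - 6399),
      8 * (m * N^2 + 5 * N^2 - 5 * m * N - 45 * N + 108)^2)"
  unfolding assms weighted_scale_def prod.case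
  by (intro arg_cong2[where f = Pair]; algebra)

lemma igusa_clebsch_of_clebsch_sparse_factored:
  fixes u v x y m :: complex
  assumes "b 0 = 60 * (v^2 * y^3)" "b 1 = - (20 * (u * v^2 * y^2))" "b 2 = 0" "b 3 = 30 * (u * v * x * y)"
    "b 4 = 0" "b 5 = - (20 * (u^2 * v * x^2))" "b 6 = 60 * (u^2 * x^3)"
    and "u * v = N" "u + v = 2 * m" "x * y = h" "h = 5 - N"
  shows "igusa_clebsch_of_clebsch (clebsch_invariants b) = weighted_scale (10 * (h^2 * N^2))
     (20 * (2 * N - 3), 25 * (N - 9)^2,
      5 * (75 * N^3 + 72 * m * N^2 - 1165 * N^2 - 360 * m * N + 5985 * N - 6399),
      8 * (m * N^2 + 5 * N^2 - 5 * m * N - 45 * N + 108)^2)"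
  using igusa_clebsch_of_clebsch_sparse[of b, OF assms(1-7)] sparse_invariants_factor[of h N "u + v" m] assms(8-11)
  by (metis (no_types))

lemma (in sqrt5_extension) conj5_power:
  "z \<in> adjoin_sqrt5 k \<Longrightarrow> z^n \<in> adjoin_sqrt5 k \<and> conj5 k (z^n) = conj5 k z ^ n"
  by (induction n) (use adjoin_sqrt5_base[OF closed(2)] conj5_base[OF closed(2)] in \<open>simp_all add: mult_in conj5_mult\<close>)

lemma (in sqrt5_extension) weierstrass_rhs_eq:
  fixes \<mu> \<eta> :: complex
  assumes \<mu>: "\<mu> \<in> adjoin_sqrt5 k" and \<eta>: "\<eta> \<in> adjoin_sqrt5 k"
  defines "M \<equiv> conj5 k \<mu>" and "H \<equiv> conj5 k \<eta>" and "N \<equiv> norm5 k \<mu>"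
  shows "weierstrass_rhs k \<mu> \<eta> = to_fract (subst_form 6
    [:M^2 * H^3, - (2 * N * M * H^2), 0, - (10 * N * (N - 5)), 0, - (2 * N * \<mu> * \<eta>^2),
      \<mu>^2 * \<eta>^3:]
    [:1, - sqrt5:] [:1, sqrt5:])"
proof -
  define P Q :: "complex poly" where "P = [:1, - sqrt5:]" and "Q = [:1, sqrt5:]"
  let ?F = "to_fract :: complex poly \<Rightarrow> _"
  let ?c = "- (5 * N * (N - 5))"
  define R where "R = [:\<mu>^2 * \<eta>^3:] * P^3 + [:- (2 * N) * (\<mu> * \<eta>^2):] * (P^2 * Q) + [:?c:] * Q^3"
  have PQ: "P \<noteq> 0" "Q \<noteq> 0" "[:1, 0, -5:] = P * Q"
    by (auto simp: P_def Q_def simp flip: of_real_mult)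
  have N: "N \<in> k" "- (2 * N) \<in> k" "?c \<in> k"
    using norm5_in[OF \<mu>] by (auto simp: N_def intro!: closed numeral_in)
  have K: "\<mu>^2 * \<eta>^3 \<in> adjoin_sqrt5 k" "conj5 k (\<mu>^2 * \<eta>^3) = M^2 * H^3"
    "- (2 * N) * (\<mu> * \<eta>^2) \<in> adjoin_sqrt5 k" "conj5 k (- (2 * N) * (\<mu> * \<eta>^2)) = - (2 * N) * (M * H^2)"
    "?c \<in> adjoin_sqrt5 k" "conj5 k ?c = ?c"
    unfolding M_def H_def
    using conj5_power[OF \<mu>] conj5_power[OF \<eta>] \<mu> adjoin_sqrt5_base[OF N(2)] adjoin_sqrt5_base[OF N(3)]
      conj5_base[OF N(2)] conj5_base[OF N(3)]
    by (simp_all only: mult_in conj5_mult)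
  have ns: "- sqrt5 \<in> adjoin_sqrt5 k" "conj5 k (- sqrt5) = sqrt5"
    using adjoin_sqrt5I[OF closed(1) closed(5)[OF closed(2)]] conj5_eq[OF closed(1) closed(5)[OF closed(2)]]
    by simp_all
  have lin: "P \<in> KX" "cj P = Q" "Q \<in> KX" "cj Q = P"
    using ns sqrt5_in_adjoin adjoin_sqrt5_base[OF closed(1)] adjoin_sqrt5_base[OF closed(2)] closed(2)
    by (auto simp: P_def Q_def polys_over_def poly_eq_iff coeff_pCons conj5_base conj5_sqrt5 split: nat.split)
  have R: "R \<in> KX" "cj R = [:M^2 * H^3:] * Q^3 + [:- (2 * N) * (M * H^2):] * (Q^2 * P) + [:?c:] * P^3"
    unfolding R_def power2_eq_square power3_eq_cube
    using K lin by (simp_all add: KX_add KX_mult KX_const power2_eq_square power3_eq_cube del: mult_pCons_left)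
  have Q3: "Q^3 \<in> KX" "cj (Q^3) = P^3" "Q^3 \<noteq> 0"
    using lin PQ by (simp_all add: KX_mult power3_eq_cube)
  have FQ: "?F Q \<noteq> 0" "?F P \<noteq> 0" using PQ by auto
  have pow: "?F (p^n) = ?F p ^ n" for p n
    by (induction n) simp_all
  have conj: "rat_conj5 k (?F R / ?F Q ^ 3) = ?F (cj R) / ?F P ^ 3"
    using rat_conj5_Fract[OF R(1) Q3(1,3)] Q3(2) by (simp add: Fract_conv_to_fract pow)
  have "const_rat (\<mu>^2 * \<eta>^3) * (?F P / ?F Q)^3 - const_rat (2 * N * \<mu> * \<eta>^2) * (?F P / ?F Q)^2
      - const_rat (5 * N * (N - 5)) = ?F R / ?F Q ^ 3"
  proof -
    have c: "const_rat (2 * N * \<mu> * \<eta>^2) = - ?F [:- (2 * N) * (\<mu> * \<eta>^2):]" "const_rat (5 * N * (N - 5)) = - ?F [:?c:]"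
      by (simp_all add: const_rat_def mult.assoc flip: to_fract_uminus)
    have "u * (p / q)^3 - - v * (p / q)^2 - - w = (u * p^3 + v * (p^2 * q) + w * q^3) / q^3" if "q \<noteq> 0"
      for u v w p q :: "complex poly fract"
      using that by (simp add: field_simps power2_eq_square power3_eq_cube)
    then show ?thesis
      unfolding c R_def to_fract_add to_fract_mult pow const_rat_def[of "\<mu>^2 * \<eta>^3"] using FQ by blast
  qed
  then have "weierstrass_rhs k \<mu> \<eta> = (?F R / ?F Q ^ 3 + ?F (cj R) / ?F P ^ 3) * ?F ((P * Q)^3)"
    unfolding weierstrass_rhs_def rat_trace5_def Let_def PQ(3) P_def[symmetric] Q_def[symmetric] N_def[symmetric]
    by (simp add: conj)
  also have "\<dots> = ?F (R * P^3 + cj R * Q^3)"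
  proof -
    have "(a / q^3 + b / p^3) * (p * q)^3 = a * p^3 + b * q^3" if "p \<noteq> 0" "q \<noteq> 0"
      for a b p q :: "complex poly fract"
      using that by (simp add: field_simps)
    then show ?thesis
      unfolding to_fract_add to_fract_mult pow using FQ by blast
  qed
  also have "R * P^3 + cj R * Q^3 = subst_form 6 [:M^2 * H^3, - (2 * N * M * H^2), 0, - (10 * N * (N - 5)), 0,
      - (2 * N * \<mu> * \<eta>^2), \<mu>^2 * \<eta>^3:] P Q"
  proof (rule poly_eqI_off_roots[OF PQ(2)])
    fix x
    show "poly (R * P^3 + cj R * Q^3) x = poly (subst_form 6 [:M^2 * H^3, - (2 * N * M * H^2), 0,
        - (10 * N * (N - 5)), 0, - (2 * N * \<mu> * \<eta>^2), \<mu>^2 * \<eta>^3:] P Q) x"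
      unfolding R(2) unfolding R_def subst_form_def
      by (simp add: eval_nat_numeral) algebra
  qed
  finally show ?thesis
    unfolding P_def Q_def .
qed

text \<open>Any root of \<open>F\<close> serves as \<open>x0\<close>. A double root would put the
  square of a form \<open>D\<close> into the substituted sextic: either \<open>D\<close> is not
  constant, against squarefreeness, or the double root has gone to infinity and the degree is at
  most 4.\<close>

lemma simple_root_of_squarefree_subst_form:
  assumes F: "degree F = 6" and sf: "squarefree (subst_form 6 F P Q)" and deg: "4 < degree (subst_form 6 F P Q)"
    and PQ: "degree P \<le> 1" "degree Q \<le> 1" "Q \<noteq> 0"
  obtains x0 H where "F = [:- x0, 1:] * H" "degree H = 5" "poly H x0 \<noteq> 0"
proof -
  obtain x0 where "poly F x0 = 0"
    using alg_closed_imp_poly_has_root[of F] F by auto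
  then obtain H where H: "F = [:- x0, 1:] * H"
    unfolding poly_eq_0_iff_dvd by (rule dvdE)
  have "H \<noteq> 0" using H F by auto
  then have H5: "degree H = 5"
    using F unfolding H by (subst (asm) degree_mult_eq) auto
  have "poly H x0 \<noteq> 0"
  proof
    assume "poly H x0 = 0"
    then obtain G where G: "H = [:- x0, 1:] * G"
      unfolding poly_eq_0_iff_dvd by (rule dvdE)
    have "G \<noteq> 0" using G \<open>H \<noteq> 0\<close> by auto
    then have G4: "degree G = 4"
      using H5 unfolding G by (subst (asm) degree_mult_eq) auto
    define D where "D = subst_form 1 [:- x0, 1:] P Q"
    have "subst_form 6 F P Q = D * subst_form 5 H P Q"
      unfolding H D_def using subst_form_mult[of "[:- x0, 1:]" 1 H 5 Q P] H5 PQ by simp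
    also have "subst_form 5 H P Q = D * subst_form 4 G P Q"
      unfolding G D_def using subst_form_mult[of "[:- x0, 1:]" 1 G 4 Q P] G4 PQ by simp
    finally have eq: "subst_form 6 F P Q = D^2 * subst_form 4 G P Q"
      by (simp add: power2_eq_square mult.assoc)
    then have "D dvd 1"
      using sf by (simp add: squarefree_def)
    then have "degree D = 0"
      using is_unit_iff_degree[of D] by fastforce
    then have "degree (subst_form 6 F P Q) \<le> 4"
      unfolding eq using degree_mult_le[of "D^2" "subst_form 4 G P Q"] degree_power_le[of D 2]
        degree_subst_form_le[OF PQ(1,2), of 4 G] by simp
    then show False using deg by simp
  qed
  then show thesis
    using that H H5 by blast
qed

section \<open>Comparison of points in weighted projective space\<close>

lemma weighted_scale_mult: "weighted_scale r (weighted_scale s I) = weighted_scale (r * s) I"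
  by (simp add: weighted_scale_def power_mult_distrib split: prod.splits)

lemma same_weighted_point_scale:
  assumes "r \<noteq> 0" "I \<noteq> (0, 0, 0, 0)"
  shows "same_weighted_point (weighted_scale r I) I"
proof -
  obtain a b c d where I: "I = (a, b, c, d)" by (cases I)
  have "\<exists>s. s \<noteq> 0 \<and> a = s * (r * a) \<and> b = s^2 * (r^2 * b) \<and> c = s^3 * (r^3 * c) \<and> d = s^5 * (r^5 * d)"
    using assms(1) by (intro exI[of _ "1 / r"]) (simp add: power_divide)
  then show ?thesis
    using assms unfolding I by (simp add: weighted_scale_def)
qed

theorem proposition6p1:
  fixes k :: "complex set" and m n \<eta> \<mu> \<nu> :: complex and f :: "complex poly"
  assumes "is_subfield k" and "sqrt5 \<notin> k"
    and "m \<in> k" and "n \<in> k"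
    and "\<eta> \<in> adjoin_sqrt5 k" and "\<eta> \<noteq> 0" and "norm5 k \<eta> = - (m^2 - 5 * n^2 - 5)"
    and "\<mu> = m + n * sqrt5" and "\<nu> = m^2 - 5 * n^2"
    and "to_fract f = weierstrass_rhs k \<mu> \<eta>"
    and "genus2_weierstrass f"
  shows "same_weighted_point (igusa_clebsch f)
    (20 * (2 * \<nu> - 3),
     25 * (\<nu> - 9)^2,
     5 * (75 * \<nu>^3 + 72 * m * \<nu>^2 - 1165 * \<nu>^2 - 360 * m * \<nu> + 5985 * \<nu> - 6399),
     8 * (m * \<nu>^2 + 5 * \<nu>^2 - 5 * m * \<nu> - 45 * \<nu> + 108)^2)"
    (is "same_weighted_point _ ?T")
proof -
  interpret sqrt5_extension k
    using assms(1,2) by unfold_locales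
  define M H h P Q where "M = conj5 k \<mu>" and "H = conj5 k \<eta>" and "h = \<eta> * H"
    and "P = [:1, - sqrt5:]" and "Q = [:1, sqrt5:]"
  have M: "M = m - n * sqrt5"
    unfolding M_def assms(8) by (rule conj5_eq) fact+
  have \<mu>: "\<mu> \<in> adjoin_sqrt5 k"
    unfolding assms(8) by (rule adjoin_sqrt5I) fact+
  have \<nu>: "norm5 k \<mu> = \<nu>" "\<mu> * M = \<nu>"
    using norm5_eq[OF assms(3,4)] by (simp_all add: assms(8,9) norm5_def M_def)
  have h: "h = 5 - \<nu>"
    using assms(7,9) by (simp add: norm5_def h_def H_def)
  have S: "\<mu> + M = 2 * m"
    by (simp add: assms(8) M)
  define F where "F = [:M^2 * H^3, - (2 * \<nu> * M * H^2), 0, - (10 * \<nu> * (\<nu> - 5)), 0,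
    - (2 * \<nu> * \<mu> * \<eta>^2), \<mu>^2 * \<eta>^3:]"
  have f: "f = subst_form 6 F P Q"
    using assms(10) unfolding weierstrass_rhs_eq[OF \<mu> assms(5)] \<nu>(1) F_def P_def Q_def M_def H_def
    by (simp only: to_fract_eq_iff)
  have PQ: "degree P \<le> 1" "degree Q \<le> 1" "Q \<noteq> 0"
    by (simp_all add: P_def Q_def)
  have "bracket P Q = - 2 * sqrt5"
    by (simp add: bracket_def P_def Q_def)
  then have "bracket P Q ^ 6 = 64 * (sqrt5 * sqrt5)^3"
    by (simp add: eval_nat_numeral)
  then have br: "bracket P Q ^ 6 = 8000"
    unfolding sqrt5_square by simp
  have g2: "degree f \<in> {5, 6}" "squarefree f"
    using assms(11) by (simp_all add: genus2_weierstrass_def)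
  \<comment> \<open>If the norm vanished, \<open>\<mu>\<close> and its conjugate would both be 0,
    and with them every coefficient of \<open>F\<close>.\<close>
  have "\<nu> \<noteq> 0"
  proof
    assume "\<nu> = 0"
    then have "\<mu> = 0 \<or> M = 0"
      using \<nu>(2) by simp
    then have "\<mu> = 0" "M = 0"
      using conj5_conj5[OF \<mu>] by (auto simp: M_def)
    then have "f = 0"
      using \<open>\<nu> = 0\<close> by (simp add: f F_def subst_form_def)
    then show False using g2 by simp
  qed
  have "H \<noteq> 0"
    using conj5_conj5[OF assms(5)] assms(6) by (auto simp: H_def)
  then have "h \<noteq> 0"
    using assms(6) by (simp add: h_def)
  have "\<mu> \<noteq> 0"
    using \<nu>(2) \<open>\<nu> \<noteq> 0\<close> by auto
  then have F6: "degree F = 6"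
    using assms(6) by (simp add: F_def)
  obtain x0 G where "F = [:- x0, 1:] * G" "degree G = 5" "poly G x0 \<noteq> 0"
  proof (rule simple_root_of_squarefree_subst_form[OF F6 _ _ PQ])
    show "squarefree (subst_form 6 F P Q)" "4 < degree (subst_form 6 F P Q)"
      using g2 unfolding f by auto
  qed
  then have "igusa_clebsch F = igusa_clebsch_coeffs F"
    by (rule igusa_clebsch_eq_coeffs_sextic)
  also have "\<dots> = weighted_scale (10 * (h^2 * \<nu>^2)) ?T"
  proof (rule igusa_clebsch_of_clebsch_sparse_factored[OF _ _ _ _ _ _ _ \<nu>(2) S h_def[symmetric] h])
    \<comment> \<open>The middle coefficient takes the form required of \<open>b 3\<close> through
      \<open>\<nu> - 5 = - h\<close>.\<close>
    have "10 * \<nu> * (\<nu> - 5) = - (10 * (\<nu> * h))"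
      unfolding h by (simp add: algebra_simps)
    then have "10 * \<nu> * (\<nu> - 5) = - (10 * (\<mu> * M * \<eta> * H))"
      by (simp add: h_def \<nu>(2)[symmetric] mult.assoc)
    then show "scaled_coeff F 3 = 30 * (\<mu> * M * \<eta> * H)"
      by (simp add: scaled_coeff_def F_def eval_nat_numeral)
  qed (simp_all add: scaled_coeff_def F_def eval_nat_numeral flip: \<nu>(2))
  finally have "igusa_clebsch f = weighted_scale 8000 (weighted_scale (10 * (h^2 * \<nu>^2)) ?T)"
    unfolding f using igusa_clebsch_subst_form[OF _ PQ, of F] F6 br by simp
  then have ic: "igusa_clebsch f = weighted_scale (8000 * (10 * (h^2 * \<nu>^2))) ?T"
    by (simp only: weighted_scale_mult)
  \<comment> \<open>The first two coordinates cannot vanish together, since that would force both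
    \<open>2 * \<nu> = 3\<close> and \<open>\<nu> = 9\<close>.\<close>
  have T0: "?T \<noteq> (0, 0, 0, 0)"
  proof
    assume "?T = (0, 0, 0, 0)"
    then have "2 * \<nu> = 3" "\<nu> = 9"
      by auto
    then have "2 * 9 = (3 :: complex)"
      by (simp only:)
    then show False by simp
  qed
  have t0: "8000 * (10 * (h^2 * \<nu>^2)) \<noteq> 0"
    using \<open>h \<noteq> 0\<close> \<open>\<nu> \<noteq> 0\<close> by simp
  show ?thesis
    unfolding ic by (rule same_weighted_point_scale[OF t0 T0])
qed

end
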